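(* For every $2\le n\le\infty$, the operator system $\mathcal{S}_n$ is not (min, max)-nuclear; that is, there exists an operator system $\mathcal{T}$ such that $\mathcal{S}_n\otimes_{\min}\mathcal{T}\ne\mathcal{S}_n\otimes_{\max}\mathcal{T}$.
   Context: For $2\le n<\infty$, $\mathcal{O}_n$ is the Cuntz algebra generated by isometries $S_1,\dots,S_n$ with $\sum_{i=1}^n S_iS_i^*=I$, and $\mathcal{S}_n=\operatorname{span}\{I,S_1,\dots,S_n,S_1^*,\dots,S_n^*\}$. For $n=\infty$, $\mathcal{O}_\infty$ is the Cuntz algebra generated by isometries $S_1,S_2,\dots$ with $\sum_{i=1}^kS_iS_i^*\le I$ for all $k<\infty$, and $\mathcal{S}_\infty=\operatorname{span}\{I,S_1,S_2,\dots,S_1^*,S_2^*,\dots\}$. For operator systems $\mathcal{S},\mathcal{T}$, the tensor products $\mathcal{S}\otimes_{\min}\mathcal{T}$ and $\mathcal{S}\otimes_{\max}\mathcal{T}$ are the algebraic tensor product with order unit $1_{\mathcal S}\otimes 1_{\mathcal T}$ and the following matrix cones. Min: $u\in M_p(\mathcal{S}\otimes_{\min}\mathcal{T})^+$ iff $(\varphi\otimes\psi)^{(p)}(u)\ge 0$ for all unital completely positive $\varphi:\mathcal{S}\to M_k$, $\psi:\mathcal{T}\to M_m$, all $k,m$. Max: $u\in M_p(\mathcal{S}\otimes_{\max}\mathcal{T})^+$ iff for every $\epsilon>0$ there are $k,m$, $P\in M_k(\mathcal{S})^+$, $Q\in M_m(\mathcal{T})^+$ and a scalar $p\times km$ matrix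 $X$ with $\epsilon\, (I_p\otimes 1_{\mathcal{S}}\otimes 1_{\mathcal{T}})+u=X(P\otimes Q)X^*$. Equality of the two means that the identity map is a complete order isomorphism. *)

theory Defs
  imports
    Complex_Main
    "HOL-Library.Extended_Nat"
    "HOL-Library.Function_Algebras"
    "Jordan_Normal_Form.Matrix"
begin

section \<open>Complex vector spaces and Hilbert spaces\<close>

class complex_vector = ab_group_add +
  fixes scaleC :: "complex \<Rightarrow> 'a \<Rightarrow> 'a" (infixr "*\<^sub>C" 75)
  assumes scaleC_add_right: "c *\<^sub>C (x + y) = c *\<^sub>C x + c *\<^sub>C y"
    and scaleC_add_left: "(c + d) *\<^sub>C x = c *\<^sub>C x + d *\<^sub>C x"
    and scaleC_scaleC: "c *\<^sub>C (d *\<^sub>C x) = (c * d) *\<^sub>C x"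
    and scaleC_one: "1 *\<^sub>C x = x"

global_interpretation cvec: vector_space "scaleC :: complex \<Rightarrow> 'a \<Rightarrow> 'a :: complex_vector"
  by unfold_locales
    (simp_all add: scaleC_add_right scaleC_add_left scaleC_scaleC scaleC_one)

instantiation complex :: complex_vector
begin
definition "c *\<^sub>C (x :: complex) = c * x"
instance by standard (simp_all add: scaleC_complex_def algebra_simps)
end

instantiation "fun" :: (type, complex_vector) complex_vector
begin
definition "c *\<^sub>C (f :: 'a \<Rightarrow> 'b) = (\<lambda>x. c *\<^sub>C f x)"
instance by standard
  (simp_all add: scaleC_fun_def plus_fun_def scaleC_add_right scaleC_add_left
    scaleC_scaleC scaleC_one)
end

text \<open>The inner product is linear in the first argument.\<close>

class chilbert_space = complex_vector + banach +
  fixes cinner :: "'a \<Rightarrow> 'a \<Rightarrow> complex"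
  assumes scaleR_scaleC: "r *\<^sub>R x = complex_of_real r *\<^sub>C x"
    and cinner_commute: "cinner x y = cnj (cinner y x)"
    and cinner_add_left: "cinner (x + y) z = cinner x z + cinner y z"
    and cinner_scaleC_left: "cinner (c *\<^sub>C x) y = c * cinner x y"
    and cinner_self: "cinner x x = complex_of_real ((norm x)\<^sup>2)"

text \<open>Operators on a Hilbert space are functions; their vector space operations are pointwise.\<close>

definition adj :: "('h \<Rightarrow> 'h) \<Rightarrow> 'h \<Rightarrow> 'h :: chilbert_space" where
  "adj A = (THE B. \<forall>x y. cinner (A x) y = cinner x (B y))"

definition isometry :: "('h \<Rightarrow> 'h :: chilbert_space) \<Rightarrow> bool" where
  "isometry A \<longleftrightarrow> Vector_Spaces.linear scaleC scaleC A \<and> (\<forall>x. norm (A x) = norm x)"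

text \<open>The order on \<^typ>\<open>complex\<close> is that of \<^theory>\<open>HOL-Library.Complex_Order\<close>: \<^prop>\<open>0 \<le> (z::complex)\<close>
  says that \<^term>\<open>z\<close> is real and nonnegative.\<close>

definition op_le :: "('h \<Rightarrow> 'h) \<Rightarrow> ('h \<Rightarrow> 'h :: chilbert_space) \<Rightarrow> bool" where
  "op_le A B \<longleftrightarrow> (\<forall>x. 0 \<le> cinner (B x - A x) x)"

text \<open>A matrix of operators is positive if it is positive as an operator on the \<open>p\<close>-fold
  direct sum of the Hilbert space with itself.\<close>

definition op_mat_pos :: "('h \<Rightarrow> 'h :: chilbert_space) mat \<Rightarrow> bool" where
  "op_mat_pos A \<longleftrightarrow> dim_row A = dim_col A \<and>
    (\<forall>\<xi> :: nat \<Rightarrow> 'h. 0 \<le> (\<Sum>i<dim_row A. \<Sum>j<dim_col A. cinner ((A $$ (i, j)) (\<xi> j)) (\<xi> i)))"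

definition psd :: "complex mat \<Rightarrow> bool" where
  "psd A \<longleftrightarrow> dim_row A = dim_col A \<and>
    (\<forall>v \<in> carrier_vec (dim_row A). 0 \<le> (A *\<^sub>v v) \<bullet>c v)"


section \<open>Operator systems\<close>

text \<open>\<^term>\<open>os_cone S p\<close> is the cone $M_p(S)^+$.  The operator system lives on a subspace of an
  ambient complex vector space; only the values of \<^term>\<open>os_star S\<close> on that subspace matter.\<close>

record 'a opsys =
  os_space :: "'a set"
  os_star :: "'a \<Rightarrow> 'a"
  os_unit :: 'a
  os_cone :: "nat \<Rightarrow> 'a mat set"

definition mats :: "nat \<Rightarrow> 'a set \<Rightarrow> 'a mat set" where
  "mats p V = {A \<in> carrier_mat p p. \<forall>i<p. \<forall>j<p. A $$ (i, j) \<in> V}"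

definition hermitian_mats :: "('a, 'b) opsys_scheme \<Rightarrow> nat \<Rightarrow> 'a mat set" where
  "hermitian_mats S p =
    {A \<in> mats p (os_space S). \<forall>i<p. \<forall>j<p. A $$ (i, j) = os_star S (A $$ (j, i))}"

definition diag :: "nat \<Rightarrow> 'a :: zero \<Rightarrow> 'a mat" where
  "diag p e = mat p p (\<lambda>(i, j). if i = j then e else 0)"

text \<open>The product $X A X^*$ of a scalar matrix \<open>X\<close>, a matrix \<open>A\<close> of vectors and $X^*$.\<close>

definition conjugation :: "complex mat \<Rightarrow> 'a :: complex_vector mat \<Rightarrow> 'a mat" where
  "conjugation X A = mat (dim_row X) (dim_row X) (\<lambda>(i, j).
    \<Sum>a<dim_row A. \<Sum>b<dim_col A. (X $$ (i, a) * cnj (X $$ (j, b))) *\<^sub>C (A $$ (a, b)))"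

text \<open>Abstract operator systems: matrix ordered *-vector spaces with an Archimedean matrix
  order unit.  Closure of the cones under nonnegative multiples is the case of a
  scalar multiple of the identity in the compatibility condition.\<close>

definition operator_system :: "('a :: complex_vector, 'b) opsys_scheme \<Rightarrow> bool" where
  "operator_system S \<longleftrightarrow>
    cvec.subspace (os_space S) \<and>
    (\<forall>x \<in> os_space S. os_star S x \<in> os_space S \<and> os_star S (os_star S x) = x) \<and>
    (\<forall>x \<in> os_space S. \<forall>y \<in> os_space S. os_star S (x + y) = os_star S x + os_star S y) \<and>
    (\<forall>c. \<forall>x \<in> os_space S. os_star S (c *\<^sub>C x) = cnj c *\<^sub>C os_star S x) \<and>
    os_unit S \<in> os_space S \<and> os_star S (os_unit S) = os_unit S \<and>
    (\<forall>p. os_cone S p \<subseteq> hermitian_mats S p) \<and>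
    (\<forall>p. \<forall>A \<in> os_cone S p. \<forall>B \<in> os_cone S p. A + B \<in> os_cone S p) \<and>
    (\<forall>p q. \<forall>A \<in> os_cone S p. \<forall>X \<in> carrier_mat q p. conjugation X A \<in> os_cone S q) \<and>
    (\<forall>p. \<forall>A \<in> os_cone S p. - A \<in> os_cone S p \<longrightarrow> A = 0\<^sub>m p p) \<and>
    (\<forall>p. \<forall>A \<in> hermitian_mats S p. \<exists>r::real. r > 0 \<and>
      diag p (complex_of_real r *\<^sub>C os_unit S) + A \<in> os_cone S p) \<and>
    (\<forall>p. \<forall>A \<in> mats p (os_space S).
      (\<forall>\<epsilon>::real. \<epsilon> > 0 \<longrightarrow> diag p (complex_of_real \<epsilon> *\<^sub>C os_unit S) + A \<in> os_cone S p) \<longrightarrow>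
      A \<in> os_cone S p)"

text \<open>The operator system structure that a unital self-adjoint space \<open>V\<close> of bounded
  operators inherits from $B(H)$, $M_p(B(H))$ being $B(H^p)$.\<close>

definition concrete_system :: "('h \<Rightarrow> 'h :: chilbert_space) set \<Rightarrow> ('h \<Rightarrow> 'h) opsys" where
  "concrete_system V = \<lparr>os_space = V, os_star = adj, os_unit = id,
    os_cone = (\<lambda>p. {A \<in> mats p V. op_mat_pos A})\<rparr>"

text \<open>For a linear map $\varphi : S \to M_k$, \<open>amplify p k \<phi> A\<close> is $\varphi^{(p)}(A)$, an element
  of $M_p(M_k) = M_{pk}$.\<close>

definition linear_into_mats :: "'a :: complex_vector set \<Rightarrow> nat \<Rightarrow> ('a \<Rightarrow> complex mat) \<Rightarrow> bool" where
  "linear_into_mats V k \<phi> \<longleftrightarrow>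
    (\<forall>x \<in> V. \<phi> x \<in> carrier_mat k k) \<and>
    (\<forall>x \<in> V. \<forall>y \<in> V. \<phi> (x + y) = \<phi> x + \<phi> y) \<and>
    (\<forall>c. \<forall>x \<in> V. \<phi> (c *\<^sub>C x) = c \<cdot>\<^sub>m \<phi> x)"

definition amplify :: "nat \<Rightarrow> nat \<Rightarrow> ('a \<Rightarrow> complex mat) \<Rightarrow> 'a mat \<Rightarrow> complex mat" where
  "amplify p k \<phi> A = mat (p * k) (p * k) (\<lambda>(i, j).
    \<phi> (A $$ (i div k, j div k)) $$ (i mod k, j mod k))"

definition ucp :: "('a :: complex_vector, 'b) opsys_scheme \<Rightarrow> nat \<Rightarrow> ('a \<Rightarrow> complex mat) \<Rightarrow> bool" where
  "ucp S k \<phi> \<longleftrightarrow> linear_into_mats (os_space S) k \<phi> \<and> \<phi> (os_unit S) = 1\<^sub>m k \<and>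
    (\<forall>p. \<forall>A \<in> os_cone S p. psd (amplify p k \<phi> A))"


section \<open>Tensor products\<close>

text \<open>The algebraic tensor product of \<open>V\<close> and \<open>W\<close> is realised inside the dual of the space
  of bilinear forms on \<open>V \<times> W\<close>: the elementary tensor of \<open>x\<close> and \<open>y\<close> is evaluation
  at \<open>(x, y)\<close>.  A bilinear form is a function on the ambient types of which only the values
  on \<open>V \<times> W\<close> matter; functionals are 0 at functions that are not bilinear there.\<close>

type_synonym ('a, 'b) tensor = "('a \<Rightarrow> 'b \<Rightarrow> complex) \<Rightarrow> complex"

definition bilinear_forms ::
  "'a :: complex_vector set \<Rightarrow> 'b :: complex_vector set \<Rightarrow> ('a \<Rightarrow> 'b \<Rightarrow> complex) set" where
  "bilinear_forms V W = {\<beta>.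
    (\<forall>x \<in> V. \<forall>x' \<in> V. \<forall>y \<in> W. \<beta> (x + x') y = \<beta> x y + \<beta> x' y) \<and>
    (\<forall>x \<in> V. \<forall>y \<in> W. \<forall>y' \<in> W. \<beta> x (y + y') = \<beta> x y + \<beta> x y') \<and>
    (\<forall>c. \<forall>x \<in> V. \<forall>y \<in> W. \<beta> (c *\<^sub>C x) y = c * \<beta> x y \<and> \<beta> x (c *\<^sub>C y) = c * \<beta> x y)}"

definition elem_tensor ::
  "('a :: complex_vector) opsys \<Rightarrow> ('b :: complex_vector) opsys \<Rightarrow> 'a \<Rightarrow> 'b \<Rightarrow> ('a, 'b) tensor" where
  "elem_tensor S T x y =
    (\<lambda>\<beta>. if \<beta> \<in> bilinear_forms (os_space S) (os_space T) then \<beta> x y else 0)"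

definition tensor_space ::
  "('a :: complex_vector) opsys \<Rightarrow> ('b :: complex_vector) opsys \<Rightarrow> ('a, 'b) tensor set" where
  "tensor_space S T = cvec.span {elem_tensor S T x y |x y. x \<in> os_space S \<and> y \<in> os_space T}"

text \<open>The conjugate-linear involution taking $x \otimes y$ to $x^* \otimes y^*$.\<close>

definition tensor_star ::
  "('a :: complex_vector) opsys \<Rightarrow> ('b :: complex_vector) opsys \<Rightarrow> ('a, 'b) tensor \<Rightarrow> ('a, 'b) tensor" where
  "tensor_star S T u = (\<lambda>\<beta>. cnj (u (\<lambda>x y. cnj (\<beta> (os_star S x) (os_star T y)))))"

text \<open>The linear map $\varphi \otimes \psi$ into $M_k \otimes M_m = M_{km}$.  The index \<open>i\<close> of $M_{km}$
  stands for the pair \<open>(i div m, i mod m)\<close>, so that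
  \<open>x \<otimes> y\<close> goes to the Kronecker product of \<open>\<phi> x\<close> and \<open>\<psi> y\<close>.\<close>

definition tensor_map ::
  "nat \<Rightarrow> nat \<Rightarrow> ('a \<Rightarrow> complex mat) \<Rightarrow> ('b \<Rightarrow> complex mat) \<Rightarrow> ('a, 'b) tensor \<Rightarrow> complex mat" where
  "tensor_map k m \<phi> \<psi> u = mat (k * m) (k * m) (\<lambda>(i, j).
    u (\<lambda>x y. \<phi> x $$ (i div m, j div m) * \<psi> y $$ (i mod m, j mod m)))"

definition tensor_mat ::
  "('a :: complex_vector) opsys \<Rightarrow> ('b :: complex_vector) opsys \<Rightarrow> nat \<Rightarrow> nat \<Rightarrow>
    'a mat \<Rightarrow> 'b mat \<Rightarrow> ('a, 'b) tensor mat" where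
  "tensor_mat S T k m P Q = mat (k * m) (k * m) (\<lambda>(i, j).
    elem_tensor S T (P $$ (i div m, j div m)) (Q $$ (i mod m, j mod m)))"

definition tensor_min ::
  "('a :: complex_vector) opsys \<Rightarrow> ('b :: complex_vector) opsys \<Rightarrow> ('a, 'b) tensor opsys" where
  "tensor_min S T = \<lparr>os_space = tensor_space S T, os_star = tensor_star S T,
    os_unit = elem_tensor S T (os_unit S) (os_unit T),
    os_cone = (\<lambda>p. {u \<in> mats p (tensor_space S T).
      \<forall>k m \<phi> \<psi>. ucp S k \<phi> \<and> ucp T m \<psi> \<longrightarrow> psd (amplify p (k * m) (tensor_map k m \<phi> \<psi>) u)})\<rparr>"

definition tensor_max ::
  "('a :: complex_vector) opsys \<Rightarrow> ('b :: complex_vector) opsys \<Rightarrow> ('a, 'b) tensor opsys" where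
  "tensor_max S T = \<lparr>os_space = tensor_space S T, os_star = tensor_star S T,
    os_unit = elem_tensor S T (os_unit S) (os_unit T),
    os_cone = (\<lambda>p. {u \<in> mats p (tensor_space S T).
      \<forall>\<epsilon>::real. \<epsilon> > 0 \<longrightarrow> (\<exists>k m. \<exists>P \<in> os_cone S k. \<exists>Q \<in> os_cone T m. \<exists>X \<in> carrier_mat p (k * m).
        diag p (complex_of_real \<epsilon> *\<^sub>C elem_tensor S T (os_unit S) (os_unit T)) + u
          = conjugation X (tensor_mat S T k m P Q))})\<rparr>"

text \<open>The identity map between two operator systems on the same vector space is a complete
  order isomorphism.\<close>

definition same_matrix_order :: "'a opsys \<Rightarrow> 'a opsys \<Rightarrow> bool" where
  "same_matrix_order S T \<longleftrightarrow> (\<forall>p. os_cone S p = os_cone T p)"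


section \<open>Cuntz isometries\<close>

text \<open>The isometries are \<open>S 0, S 1, \<dots>\<close>, that is, \<open>S i\<close> with \<^prop>\<open>enat i < n\<close>.  On the zero
  Hilbert space the relations hold trivially; it is excluded because the Cuntz algebra is nonzero.\<close>

definition cuntz_isometries :: "enat \<Rightarrow> (nat \<Rightarrow> 'h \<Rightarrow> 'h :: chilbert_space) \<Rightarrow> bool" where
  "cuntz_isometries n S \<longleftrightarrow>
    (\<exists>x :: 'h. x \<noteq> 0) \<and>
    (\<forall>i. enat i < n \<longrightarrow> isometry (S i)) \<and>
    (case n of
      enat k \<Rightarrow> (\<Sum>i<k. S i \<circ> adj (S i)) = id
    | \<infinity> \<Rightarrow> (\<forall>k. op_le (\<Sum>i<k. S i \<circ> adj (S i)) id))"

text \<open>The Cuntz algebra is the C*-algebra $O_n \subseteq B(H)$ generated by the isometries.  It does not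
  depend, up to isomorphism, on \<open>H\<close> or the isometries.  Since $M_p(O_n)^+ = M_p(O_n) \cap B(H^p)^+$, the
  operator system structure that the span inherits from $O_n$ is the one inherited from $B(H)$.\<close>

definition cuntz_system :: "enat \<Rightarrow> (nat \<Rightarrow> 'h \<Rightarrow> 'h :: chilbert_space) \<Rightarrow> ('h \<Rightarrow> 'h) opsys" where
  "cuntz_system n S = concrete_system
    (cvec.span ({id} \<union> {S i |i. enat i < n} \<union> {adj (S i) |i. enat i < n}))"

end

theory Submission
  imports Defs
begin

text \<open>Let \<open>T\<close> be the span of \<open>I\<close>, $E_{01}$, $E_{02}$, $E_{10}$, $E_{20}$ in $M_3$ (for \<open>n = 2\<close> the
  operator system dual of \<open>S\<^sub>2\<close>) and \<open>u\<close> the positive matrix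
  $\begin{pmatrix} 1 & S_1 & S_2 \cr S_1^* & 1 & 0 \cr S_2^* & 0 & 1 \end{pmatrix}$ in
  $S_n \otimes T$; it is positive in the minimal tensor product.  If
  $\epsilon (1 \otimes 1) + u = X (P \otimes Q) X^*$, then \<open>P\<close> and \<open>X\<close> give a completely positive map
  $F : M_m \to S_n$, and \<open>Q\<close> is a positive block matrix
  $\begin{pmatrix} D & A_1 & A_2 \cr A_1^* & D & 0 \cr A_2^* & 0 & D \end{pmatrix}$ with
  $F(D) = 1 + \epsilon$ and $F(A_i) = S_i$.  Because of the zero blocks \<open>D\<close> splits as $M_1 + M_2$ such that
  $\begin{pmatrix} M_i & A_i \cr A_i^* & D \end{pmatrix} \ge 0$, which makes $F(M_i)$ at least
  \<open>1 - \<epsilon>\<close> on the range of $S_i$.  But an element of $S_n$ has the same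
  quadratic form on $S_1 S_2 x$ and $S_2 S_1 x$, so that $2 (1 - \epsilon) \le 1 + \epsilon$.\<close>

section \<open>Hilbert space operators\<close>

lemma cinner_zero_left [simp]: "cinner 0 (x :: 'h :: chilbert_space) = 0"
  using cinner_add_left[of 0 0 x] by simp

lemma cinner_add_right: "cinner (x :: 'h :: chilbert_space) (y + z) = cinner x y + cinner x z"
  by (metis cinner_add_left cinner_commute complex_cnj_add)

lemma cinner_scaleC_right: "cinner (x :: 'h :: chilbert_space) (c *\<^sub>C y) = cnj c * cinner x y"
  by (metis cinner_scaleC_left cinner_commute complex_cnj_mult)

lemma cinner_zero_right [simp]: "cinner (x :: 'h :: chilbert_space) 0 = 0"
  using cinner_add_right[of x 0 0] by simp

lemma cinner_minus_left: "cinner (- x :: 'h :: chilbert_space) y = - cinner x y"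
  using cinner_add_left[of x "- x" y] by (simp add: eq_neg_iff_add_eq_0 add.commute)

lemma cinner_minus_right: "cinner (x :: 'h :: chilbert_space) (- y) = - cinner x y"
  using cinner_add_right[of x y "- y"] by (simp add: eq_neg_iff_add_eq_0 add.commute)

lemma cinner_diff_left: "cinner (x - y :: 'h :: chilbert_space) z = cinner x z - cinner y z"
  using cinner_add_left[of x "- y" z] by (simp add: cinner_minus_left)

lemma cinner_diff_right: "cinner (x :: 'h :: chilbert_space) (y - z) = cinner x y - cinner x z"
  using cinner_add_right[of x y "- z"] by (simp add: cinner_minus_right)

lemma cinner_sum_left: "cinner (sum f I :: 'h :: chilbert_space) y = (\<Sum>i\<in>I. cinner (f i) y)"
  by (induction I rule: infinite_finite_induct) (simp_all add: cinner_add_left)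

lemma cinner_sum_right: "cinner (x :: 'h :: chilbert_space) (sum f I) = (\<Sum>i\<in>I. cinner x (f i))"
  by (induction I rule: infinite_finite_induct) (simp_all add: cinner_add_right)

lemmas cinner_simps = cinner_add_left cinner_add_right cinner_diff_left cinner_diff_right
  cinner_minus_left cinner_minus_right cinner_scaleC_left cinner_scaleC_right

lemma norm_sq_Re_cinner: "(norm (x :: 'h :: chilbert_space))\<^sup>2 = Re (cinner x x)"
  by (simp add: cinner_self)

lemma norm_add_sq:
  "(norm (x + y :: 'h :: chilbert_space))\<^sup>2 = (norm x)\<^sup>2 + (norm y)\<^sup>2 + 2 * Re (cinner x y)"
  using cinner_commute[of y x] by (simp add: norm_sq_Re_cinner cinner_simps)

lemma norm_diff_sq:
  "(norm (x - y :: 'h :: chilbert_space))\<^sup>2 = (norm x)\<^sup>2 + (norm y)\<^sup>2 - 2 * Re (cinner x y)"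
  using norm_add_sq[of x "- y"] by (simp add: cinner_minus_right)

lemma parallelogram_law:
  "(norm (x + y :: 'h :: chilbert_space))\<^sup>2 + (norm (x - y))\<^sup>2 = 2 * (norm x)\<^sup>2 + 2 * (norm y)\<^sup>2"
  by (simp add: norm_add_sq norm_diff_sq)

lemma norm_scaleC_sq: "(norm (c *\<^sub>C x :: 'h :: chilbert_space))\<^sup>2 = (cmod c)\<^sup>2 * (norm x)\<^sup>2"
proof -
  have "cinner (c *\<^sub>C x) (c *\<^sub>C x) = (c * cnj c) * cinner x x"
    by (simp add: cinner_scaleC_left cinner_scaleC_right)
  also have "\<dots> = complex_of_real ((cmod c)\<^sup>2 * (norm x)\<^sup>2)"
    by (simp only: complex_norm_square[symmetric] cinner_self of_real_mult)
  finally show ?thesis by (simp only: norm_sq_Re_cinner Re_complex_of_real)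
qed

lemma cinner_self_nonneg: "0 \<le> cinner x (x :: 'h :: chilbert_space)"
  by (simp add: cinner_self less_eq_complex_def)

lemma cinner_eqI:
  assumes "\<And>z. cinner z x = cinner z (y :: 'h :: chilbert_space)"
  shows "x = y"
proof -
  have "cinner (x - y) (x - y) = 0"
    by (simp only: cinner_diff_right assms) simp
  then show ?thesis by (simp add: cinner_self)
qed

text \<open>A first-order perturbation argument: moving from \<open>r\<close> a short way along
  \<open>w\<close>, with the phase of \<open>cinner r w\<close>, would shorten \<open>r\<close> if
  the inner product were nonzero.\<close>

lemma cinner_eq_0_if_minimal:
  fixes r w :: "'h :: chilbert_space"
  assumes "\<And>c. norm r \<le> norm (r - c *\<^sub>C w)"
  shows "cinner r w = 0"
proof (rule ccontr)
  assume neq: "cinner r w \<noteq> 0"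
  define a where "a = cinner r w"
  \<comment> \<open>A step length with \<open>t * (norm w)\<^sup>2 < 1\<close>, so that the linear
    gain beats the quadratic loss; the summand 1 covers \<open>w = 0\<close>.\<close>
  define t where "t = 1 / ((norm w)\<^sup>2 + 1)"
  have "a \<noteq> 0" using neq by (simp add: a_def)
  have pos: "(norm w)\<^sup>2 + 1 > 0" by (simp add: add_nonneg_pos)
  then have t: "t > 0" "t * (norm w)\<^sup>2 < 1" by (simp_all add: t_def)
  have "(norm r)\<^sup>2 \<le> (norm (r - (of_real t * a) *\<^sub>C w))\<^sup>2"
    using assms by (intro power_mono) auto
  also have "\<dots> = (norm r)\<^sup>2 + (t * cmod a)\<^sup>2 * (norm w)\<^sup>2 - 2 * (t * (cmod a)\<^sup>2)"
  proof -
    have "Re (cinner r ((of_real t * a) *\<^sub>C w)) = Re (of_real t * (a * cnj a))"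
      by (simp add: cinner_scaleC_right a_def mult_ac)
    also have "\<dots> = t * (cmod a)\<^sup>2"
      by (simp only: complex_norm_square[symmetric]) simp
    moreover have "(norm ((of_real t * a) *\<^sub>C w))\<^sup>2 = (t * cmod a)\<^sup>2 * (norm w)\<^sup>2"
      by (simp add: norm_scaleC_sq norm_mult power_mult_distrib)
    ultimately show ?thesis by (simp add: norm_diff_sq)
  qed
  finally have "2 * (t * (cmod a)\<^sup>2) \<le> (t * (cmod a)\<^sup>2) * (t * (norm w)\<^sup>2)"
    by (simp add: power2_eq_square algebra_simps)
  moreover have "(t * (cmod a)\<^sup>2) * (t * (norm w)\<^sup>2) < (t * (cmod a)\<^sup>2) * 1"
    using t \<open>a \<noteq> 0\<close> by (intro mult_strict_left_mono) auto
  moreover have "t * (cmod a)\<^sup>2 > 0" using t \<open>a \<noteq> 0\<close> by simp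
  ultimately show False by linarith
qed

section \<open>Adjoints of isometries\<close>

locale hilbert_isometry =
  fixes A :: "'h \<Rightarrow> 'h :: chilbert_space"
  assumes isometry: "isometry A"
begin

lemma add: "A (x + y) = A x + A y"
  and scaleC: "A (c *\<^sub>C x) = c *\<^sub>C A x"
  and norm_eq [simp]: "norm (A x) = norm x"
  using isometry by (auto simp: isometry_def Vector_Spaces.linear_iff)

lemma diff: "A (x - y) = A x - A y"
  using add[of "x - y" y] by (simp add: algebra_simps)

lemma scaleR: "A (r *\<^sub>R x) = r *\<^sub>R A x"
  by (simp add: scaleR_scaleC scaleC)

text \<open>Polarization: norms determine the real part, and replacing \<open>y\<close> by
  \<open>\<i> *\<^sub>C y\<close> turns the imaginary part into a real part.\<close>

lemma cinner_eq: "cinner (A x) (A y) = cinner x y"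
proof -
  have Re: "Re (cinner (A x) (A y)) = Re (cinner x y)" for x y
    using norm_add_sq[of "A x" "A y"] norm_add_sq[of x y] by (simp add: add[symmetric])
  have "Im (cinner u v) = Re (cinner u (\<i> *\<^sub>C v))" for u v :: 'h
    by (simp add: cinner_scaleC_right)
  then have "Im (cinner (A x) (A y)) = Im (cinner x y)"
    using Re[of x "\<i> *\<^sub>C y"] by (simp add: scaleC)
  with Re show ?thesis by (simp add: complex_eq_iff)
qed

text \<open>By the parallelogram law a minimizing sequence in the range of \<open>A\<close> is
  Cauchy. Since \<open>A\<close> is isometric, the preimages \<open>X n\<close> are Cauchy too, and
  completeness gives a limit in the domain of \<open>A\<close>.\<close>

lemma nearest_point: "\<exists>x. \<forall>z. norm (y - A x) \<le> norm (y - A z)"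
proof -
  define f where "f = (\<lambda>x. (norm (y - A x))\<^sup>2)"
  define d where "d = (INF x. f x)"
  have bdd: "bdd_below (range f)" by (rule bdd_belowI[of _ 0]) (auto simp: f_def)
  have d_le: "d \<le> f x" for x
    unfolding d_def using bdd by (rule cINF_lower) simp
  have "\<exists>x. f x < d + 1 / real (Suc n)" for n
  proof -
    have "(INF x. f x) < d + 1 / real (Suc n)" by (simp add: d_def)
    then show ?thesis using cINF_less_iff[OF _ bdd] by auto
  qed
  then obtain X where X: "\<And>n. f (X n) < d + 1 / real (Suc n)" by metis
  have dist: "(norm (X m - X n))\<^sup>2 \<le> 2 / real (Suc m) + 2 / real (Suc n)" for m n
  proof -
    let ?p = "y - A (X m)" and ?q = "y - A (X n)"
    have "(norm (?p + ?q))\<^sup>2 + (norm (?p - ?q))\<^sup>2 = 2 * f (X m) + 2 * f (X n)"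
      by (simp only: f_def parallelogram_law)
    moreover have "norm (?p - ?q) = norm (X m - X n)"
      by (simp add: diff[symmetric] norm_minus_commute)
    \<comment> \<open>The image of the midpoint of \<open>X m\<close> and \<open>X n\<close>
      competes for the infimum \<open>d\<close>.\<close>
    moreover have "4 * d \<le> (norm (?p + ?q))\<^sup>2"
    proof -
      have "?p + ?q = 2 *\<^sub>R (y - A ((1/2) *\<^sub>R (X m + X n)))"
        by (simp add: scaleR add scaleR_diff_right scaleR_2)
      then have "(norm (?p + ?q))\<^sup>2 = 4 * f ((1/2) *\<^sub>R (X m + X n))"
        by (simp add: f_def power_mult_distrib)
      then show ?thesis using d_le by simp
    qed
    ultimately show ?thesis using X[of m] X[of n] by simp
  qed
  have "Cauchy X"
  proof (rule CauchyI)
    fix e :: real assume "e > 0"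
    obtain M where "4 / e\<^sup>2 < real M" using reals_Archimedean2 by blast
    then have M: "4 / e\<^sup>2 < real (Suc M)" by simp
    have "norm (X m - X n) < e" if "m \<ge> M" "n \<ge> M" for m n
    proof (rule power_less_imp_less_base)
      have "(norm (X m - X n))\<^sup>2 \<le> 2 / real (Suc M) + 2 / real (Suc M)"
        using that by (intro order_trans[OF dist] add_mono divide_left_mono) auto
      also have "\<dots> = 4 / real (Suc M)" by simp
      also have "\<dots> < e\<^sup>2" using M \<open>e > 0\<close> by (simp add: field_simps)
      finally show "(norm (X m - X n))\<^sup>2 < e\<^sup>2" .
    qed (use \<open>e > 0\<close> in simp)
    then show "\<exists>M. \<forall>m\<ge>M. \<forall>n\<ge>M. norm (X m - X n) < e" by blast
  qed
  then obtain x where x: "X \<longlonglongrightarrow> x" using Cauchy_convergent convergentD by blast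
  have "(\<lambda>n. A (X n)) \<longlonglongrightarrow> A x"
    using x by (simp add: tendsto_iff dist_norm diff[symmetric])
  then have "(\<lambda>n. f (X n)) \<longlonglongrightarrow> f x" unfolding f_def by (intro tendsto_intros)
  moreover have "(\<lambda>n. d + 1 / real (Suc n)) \<longlonglongrightarrow> d"
    using tendsto_add[OF tendsto_const LIMSEQ_Suc[OF lim_1_over_n]] by fastforce
  ultimately have "f x \<le> d"
    using X by (intro LIMSEQ_le) (auto intro: less_imp_le)
  then have "f x \<le> f z" for z using d_le[of z] by simp
  then have "norm (y - A x) \<le> norm (y - A z)" for z
    unfolding f_def using power2_le_imp_le[OF _ norm_ge_zero] by blast
  then show ?thesis by blast
qed

text \<open>If \<open>A b\<close> is the point of the range nearest to \<open>y\<close>, then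
  \<open>y - A b\<close> is orthogonal to the range; as \<open>A\<close> preserves inner products,
  \<open>b\<close> is the value of the adjoint at \<open>y\<close>.\<close>

lemma adjoint_exists: "\<exists>B. \<forall>x y. cinner (A x) y = cinner x (B y)"
proof -
  have "\<exists>b. \<forall>x. cinner (A x) y = cinner x b" for y
  proof -
    obtain b where b: "\<And>z. norm (y - A b) \<le> norm (y - A z)" using nearest_point by blast
    have "cinner (A x) y = cinner x b" for x
    proof -
      have "cinner (y - A b) (A x) = 0"
      proof (rule cinner_eq_0_if_minimal)
        fix c show "norm (y - A b) \<le> norm (y - A b - c *\<^sub>C A x)"
          using b[of "b + c *\<^sub>C x"] by (simp add: add scaleC algebra_simps)
      qed
      then have "cinner y (A x) = cinner b x" by (simp add: cinner_diff_left cinner_eq)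
      then show ?thesis by (metis cinner_commute)
    qed
    then show ?thesis by blast
  qed
  then show ?thesis by metis
qed

text \<open>\<open>adj\<close> is a definite description, so existence and uniqueness of the adjoint
  are both required before its defining property can be used.\<close>

lemma cinner_adj_right: "cinner x (adj A y) = cinner (A x) y"
proof -
  have "\<exists>!B. \<forall>x y. cinner (A x) y = cinner x (B y)"
  proof (rule ex_ex1I[OF adjoint_exists])
    fix B B' assume "\<forall>x y. cinner (A x) y = cinner x (B y)" "\<forall>x y. cinner (A x) y = cinner x (B' y)"
    then have "cinner x (B y) = cinner x (B' y)" for x y by metis
    then show "B = B'" by (intro ext cinner_eqI)
  qed
  from theI'[OF this] have "\<forall>x y. cinner (A x) y = cinner x (adj A y)"
    unfolding adj_def .
  then show ?thesis by simp
qed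

lemma cinner_adj_left: "cinner (adj A y) x = cinner y (A x)"
  using cinner_adj_right[of x y] by (metis cinner_commute)

lemma adj_add: "adj A (x + y) = adj A x + adj A y"
  by (rule cinner_eqI) (simp add: cinner_adj_right cinner_add_right)

lemma adj_scaleC: "adj A (c *\<^sub>C x) = c *\<^sub>C adj A x"
  by (rule cinner_eqI) (simp add: cinner_adj_right cinner_scaleC_right)

lemma adj_cancel: "adj A (A x) = x"
  by (rule cinner_eqI) (simp add: cinner_adj_right cinner_eq)

end

section \<open>Orthogonality of the ranges of Cuntz isometries\<close>

lemma sum_fun_apply: "sum f I x = (\<Sum>i\<in>I. f i x)"
  by (induction I rule: infinite_finite_induct) auto

text \<open>A common form of the Cuntz relations for finite and infinite \<open>n\<close>: some
  finite sum of range projections that contains both indices is bounded by the identity. For finite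
  \<open>n\<close> it is the full sum.\<close>

lemma sum_range_projections_le:
  assumes "cuntz_isometries n S" and "enat i < n" "enat j < n"
  obtains k where "i < k" "j < k" "enat k \<le> n"
    "\<And>x. Re (cinner ((\<Sum>i<k. S i \<circ> adj (S i)) x) x) \<le> (norm x)\<^sup>2"
proof (cases n)
  case (enat k)
  then show ?thesis using assms that[of k]
    by (auto simp: cuntz_isometries_def norm_sq_Re_cinner)
next
  case infinity
  have "\<forall>k. op_le (\<Sum>i<k. S i \<circ> adj (S i)) id"
    using assms(1) by (simp add: cuntz_isometries_def infinity)
  then have "op_le (\<Sum>i<Suc (max i j). S i \<circ> adj (S i)) id" by blast
  then show ?thesis using infinity that[of "Suc (max i j)"]
    by (force simp: op_le_def norm_sq_Re_cinner cinner_diff_left less_eq_complex_def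
        simp del: sum.lessThan_Suc)
qed

text \<open>The projection onto the range of \<open>S j\<close> already accounts for the whole norm
  of \<open>S j y\<close>. The bound on the sum of projections leaves nothing for
  \<open>S i\<close>.\<close>

lemma cuntz_isometries_orthogonal:
  assumes S: "cuntz_isometries n S" and ij: "enat i < n" "enat j < n" "i \<noteq> j"
  shows "cinner (S i x) (S j y) = 0"
proof -
  obtain k where k: "i < k" "j < k" "enat k \<le> n"
    and le: "\<And>x. Re (cinner ((\<Sum>i<k. S i \<circ> adj (S i)) x) x) \<le> (norm x)\<^sup>2"
    using sum_range_projections_le[OF S ij(1,2)] by blast
  have iso: "hilbert_isometry (S l)" if "l < k" for l
  proof -
    have "enat l < n" using that k(3) by (meson enat_ord_simps(2) less_le_trans)
    then show ?thesis using S by (simp add: cuntz_isometries_def hilbert_isometry_def)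
  qed
  let ?v = "S j y"
  interpret j: hilbert_isometry "S j" by (rule iso) fact
  have "(norm (adj (S j) ?v))\<^sup>2 + (norm (adj (S i) ?v))\<^sup>2 = (\<Sum>l\<in>{j,i}. (norm (adj (S l) ?v))\<^sup>2)"
    using ij by simp
  also have "\<dots> \<le> (\<Sum>l<k. (norm (adj (S l) ?v))\<^sup>2)"
    using k by (intro sum_mono2) auto
  also have "\<dots> = Re (cinner ((\<Sum>i<k. S i \<circ> adj (S i)) ?v) ?v)"
    by (simp add: sum_fun_apply cinner_sum_left norm_sq_Re_cinner
        hilbert_isometry.cinner_adj_right[OF iso])
  also have "\<dots> \<le> (norm ?v)\<^sup>2" by (rule le)
  finally have "adj (S i) ?v = 0" by (simp add: j.adj_cancel)
  then show ?thesis
    using hilbert_isometry.cinner_adj_right[OF iso[OF k(1)], of x ?v] by simp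
qed

section \<open>Positive kernels\<close>

text \<open>Positive semidefinite matrices over an arbitrary index set, so that block matrices can
  be indexed by pairs.\<close>

definition pos_kernel :: "'i set \<Rightarrow> ('i \<Rightarrow> 'i \<Rightarrow> complex) \<Rightarrow> bool" where
  "pos_kernel I N \<longleftrightarrow> (\<forall>f. 0 \<le> (\<Sum>i\<in>I. \<Sum>j\<in>I. N i j * f j * cnj (f i)))"

lemma pos_kernelD: "pos_kernel I N \<Longrightarrow> 0 \<le> (\<Sum>i\<in>I. \<Sum>j\<in>I. N i j * f j * cnj (f i))"
  by (simp add: pos_kernel_def)

lemma pos_kernel_cong:
  assumes "\<And>i j. i \<in> I \<Longrightarrow> j \<in> I \<Longrightarrow> N i j = M i j"
  shows "pos_kernel I N \<longleftrightarrow> pos_kernel I M"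
  using assms by (simp add: pos_kernel_def)

lemma pos_kernel_add: "pos_kernel I N \<Longrightarrow> pos_kernel I M \<Longrightarrow> pos_kernel I (\<lambda>i j. N i j + M i j)"
  by (simp add: pos_kernel_def distrib_right sum.distrib)

lemma pos_kernel_subset:
  assumes "pos_kernel I N" "finite I" "J \<subseteq> I"
  shows "pos_kernel J N"
  unfolding pos_kernel_def
proof
  fix f :: "'a \<Rightarrow> complex"
  define g where "g = (\<lambda>i. if i \<in> J then f i else 0)"
  have inner: "(\<Sum>j\<in>I. N i j * g j * cnj (g i)) = (\<Sum>j\<in>J. N i j * g j * cnj (g i))" for i
    using assms by (intro sum.mono_neutral_right) (auto simp: g_def)
  have "(\<Sum>i\<in>I. \<Sum>j\<in>I. N i j * g j * cnj (g i)) = (\<Sum>i\<in>J. \<Sum>j\<in>J. N i j * g j * cnj (g i))"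
    unfolding inner using assms by (intro sum.mono_neutral_right) (auto simp: g_def)
  also have "\<dots> = (\<Sum>i\<in>J. \<Sum>j\<in>J. N i j * f j * cnj (f i))"
    by (intro sum.cong refl) (auto simp: g_def)
  finally show "0 \<le> (\<Sum>i\<in>J. \<Sum>j\<in>J. N i j * f j * cnj (f i))"
    using pos_kernelD[OF assms(1), of g] by simp
qed

lemma pos_kernel_diag_nonneg:
  assumes "pos_kernel I N" "finite I" "i \<in> I"
  shows "0 \<le> N i i"
  using pos_kernelD[OF pos_kernel_subset[OF assms(1,2), of "{i}"], of "\<lambda>_. 1"] assms(3) by simp

lemma pos_kernel_pair:
  assumes "pos_kernel I N" "finite I" "i \<in> I" "j \<in> I" "i \<noteq> j"
  shows "0 \<le> N i i * a * cnj a + N i j * b * cnj a + (N j i * a * cnj b + N j j * b * cnj b)"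
  using pos_kernelD[OF pos_kernel_subset[OF assms(1,2), of "{i, j}"],
      of "\<lambda>k. if k = i then a else b"] assms(3-5)
  by simp

text \<open>Over the complex numbers a form with real values is hermitian: the vectors (1, 1) and
  (1, i) on the two coordinates compare the imaginary and the real parts of the two entries.\<close>

lemma pos_kernel_hermitian:
  assumes "pos_kernel I N" "finite I" "i \<in> I" "j \<in> I"
  shows "N j i = cnj (N i j)"
proof (cases "i = j")
  case True
  then show ?thesis using pos_kernel_diag_nonneg[OF assms(1-3)]
    by (simp add: less_eq_complex_def complex_eq_iff)
next
  case False
  note pair = pos_kernel_pair[OF assms False]
  have "Im (N i i) = 0" "Im (N j j) = 0"
    using pos_kernel_diag_nonneg[OF assms(1,2)] assms(3,4) by (auto simp: less_eq_complex_def)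
  then show ?thesis using pair[of 1 1] pair[of 1 \<i>]
    by (simp add: less_eq_complex_def complex_eq_iff)
qed

text \<open>With a zero diagonal entry the form has no quadratic term in coordinate
  \<open>i\<close>, so a nonzero off-diagonal entry would make it negative somewhere.\<close>

lemma pos_kernel_zero_diag:
  assumes "pos_kernel I N" "finite I" "i \<in> I" "j \<in> I" "N i i = 0"
  shows "N i j = 0"
proof (rule ccontr)
  assume nz: "N i j \<noteq> 0"
  then have "i \<noteq> j" using assms by auto
  define c where "c = (cmod (N i j))\<^sup>2"
  have "c > 0" using nz by (simp add: c_def)
  \<comment> \<open>Chosen so that the form takes the value -1 at the test vector.\<close>
  define s where "s = (Re (N j j) + 1) / (2 * c)"
  let ?a = "- of_real s * N i j"
  have "N i j * cnj (N i j) = of_real c" unfolding c_def by (rule complex_norm_square[symmetric])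
  then have "N i j * 1 * cnj ?a = - of_real (s * c)" "N j i * ?a * cnj 1 = - of_real (s * c)"
    using pos_kernel_hermitian[OF assms(1-4)] by (simp_all add: algebra_simps)
  note eqs = this
  have "0 \<le> N i i * ?a * cnj ?a + - of_real (s * c) + (- of_real (s * c) + N j j * 1 * cnj 1)"
    using pos_kernel_pair[OF assms(1-4) \<open>i \<noteq> j\<close>, of ?a 1] unfolding eqs .
  with assms(5) have "0 \<le> Re (N j j) - 2 * (s * c)" by (simp add: less_eq_complex_def mult.commute)
  also have "\<dots> = -1" using \<open>c > 0\<close> by (simp add: s_def field_simps)
  finally show False by simp
qed

text \<open>This is the Schur complement of the pivot \<open>p\<close>. Its form at \<open>f\<close>
  is the form of \<open>N\<close> at a vector \<open>g\<close> that differs from \<open>f\<close> in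
  coordinate \<open>p\<close> only.\<close>

lemma pos_kernel_eliminate:
  assumes "pos_kernel I N" "finite I" "p \<in> I" and d: "N p p \<noteq> 0"
  shows "pos_kernel I (\<lambda>i j. N i j - N i p * N p j / N p p)"
  unfolding pos_kernel_def
proof
  fix f :: "'a \<Rightarrow> complex"
  define l where "l = (\<Sum>j\<in>I. N p j * f j)"
  \<comment> \<open>The correction in coordinate \<open>p\<close> for which the image of
    \<open>g\<close> under \<open>N\<close> vanishes in that coordinate.\<close>
  define c where "c = - l / N p p"
  define g where "g = (\<lambda>i. f i + (if i = p then c else 0))"
  have real: "cnj (N p p) = N p p" using pos_kernel_hermitian[OF assms(1-3,3)] by simp
  have l': "(\<Sum>i\<in>I. N i p * cnj (f i)) = cnj l"
    unfolding l_def cnj_sum complex_cnj_mult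
    by (intro sum.cong refl) (simp add: pos_kernel_hermitian[OF assms(1,2,3)])
  have inner: "(\<Sum>j\<in>I. N i j * g j) = (\<Sum>j\<in>I. N i j * f j) + N i p * c" for i
    using assms(2,3) by (simp add: g_def distrib_left sum.distrib if_distrib[of "\<lambda>x. _ * x"] cong: if_cong)
  have "(\<Sum>i\<in>I. \<Sum>j\<in>I. N i j * g j * cnj (g i)) = (\<Sum>i\<in>I. (\<Sum>j\<in>I. N i j * g j) * cnj (g i))"
    by (simp add: sum_distrib_right)
  also have "\<dots> = (\<Sum>i\<in>I. ((\<Sum>j\<in>I. N i j * f j) + N i p * c) * cnj (f i))
      + (l + N p p * c) * cnj c"
    unfolding inner using assms(2,3)
    by (simp add: g_def l_def distrib_left sum.distrib if_distrib[of "\<lambda>x. _ * x"]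
        if_distrib[of cnj] cong: if_cong)
  also have "(l + N p p * c) = 0" using d by (simp add: c_def)
  also have "(\<Sum>i\<in>I. ((\<Sum>j\<in>I. N i j * f j) + N i p * c) * cnj (f i))
      = (\<Sum>i\<in>I. \<Sum>j\<in>I. N i j * f j * cnj (f i)) + c * cnj l"
    unfolding l'[symmetric] by (simp add: algebra_simps sum.distrib sum_distrib_right sum_distrib_left)
  also have "(\<Sum>i\<in>I. \<Sum>j\<in>I. N i j * f j * cnj (f i)) + c * cnj l + 0 * cnj c
     = (\<Sum>i\<in>I. \<Sum>j\<in>I. (N i j - N i p * N p j / N p p) * f j * cnj (f i))"
  proof -
    have "(\<Sum>i\<in>I. \<Sum>j\<in>I. (N i p * N p j / N p p) * f j * cnj (f i)) = (\<Sum>i\<in>I. N i p * cnj (f i)) * l / N p p"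
      unfolding l_def sum_product sum_divide_distrib by (intro sum.cong refl) simp
    then have "(\<Sum>i\<in>I. \<Sum>j\<in>I. (N i j - N i p * N p j / N p p) * f j * cnj (f i))
        = (\<Sum>i\<in>I. \<Sum>j\<in>I. N i j * f j * cnj (f i)) - cnj l * l / N p p"
      by (simp only: left_diff_distrib sum_subtractf l')
    then show ?thesis by (simp add: c_def mult.commute)
  qed
  finally show "0 \<le> (\<Sum>i\<in>I. \<Sum>j\<in>I. (N i j - N i p * N p j / N p p) * f j * cnj (f i))"
    using pos_kernelD[OF assms(1), of g] by simp
qed

lemma pos_kernel_conjugate:
  assumes "pos_kernel I N"
  shows "pos_kernel J (\<lambda>i j. \<Sum>a\<in>I. \<Sum>b\<in>I. Y i a * cnj (Y j b) * N a b)"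
  unfolding pos_kernel_def
proof
  fix f :: "'b \<Rightarrow> complex"
  define g where "g = (\<lambda>b. \<Sum>j\<in>J. cnj (Y j b) * f j)"
  have "(\<Sum>i\<in>J. \<Sum>j\<in>J. (\<Sum>a\<in>I. \<Sum>b\<in>I. Y i a * cnj (Y j b) * N a b) * f j * cnj (f i))
      = (\<Sum>i\<in>J. \<Sum>j\<in>J. \<Sum>a\<in>I. \<Sum>b\<in>I. N a b * (cnj (Y j b) * f j) * (Y i a * cnj (f i)))"
    by (simp add: sum_distrib_left sum_distrib_right mult_ac)
  also have "\<dots> = (\<Sum>a\<in>I. \<Sum>b\<in>I. \<Sum>i\<in>J. \<Sum>j\<in>J. N a b * (cnj (Y j b) * f j) * (Y i a * cnj (f i)))"
    by (simp only: sum.swap[of _ J I])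
  also have "\<dots> = (\<Sum>a\<in>I. \<Sum>b\<in>I. N a b * g b * cnj (g a))"
  proof (intro sum.cong refl)
    fix a b
    have "N a b * g b * cnj (g a)
        = N a b * ((\<Sum>i\<in>J. Y i a * cnj (f i)) * (\<Sum>j\<in>J. cnj (Y j b) * f j))"
      by (simp add: g_def)
    then show "(\<Sum>i\<in>J. \<Sum>j\<in>J. N a b * (cnj (Y j b) * f j) * (Y i a * cnj (f i)))
        = N a b * g b * cnj (g a)"
      by (simp add: sum_product sum_distrib_left mult_ac)
  qed
  finally show "0 \<le> (\<Sum>i\<in>J. \<Sum>j\<in>J. (\<Sum>a\<in>I. \<Sum>b\<in>I. Y i a * cnj (Y j b) * N a b) * f j * cnj (f i))"
    using pos_kernelD[OF assms, of g] by simp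
qed

text \<open>Reindexing is conjugation by the 0-1 matrix of \<open>h\<close>.\<close>

lemma pos_kernel_reindex:
  assumes "pos_kernel I N" "finite I" "h ` J \<subseteq> I"
  shows "pos_kernel J (\<lambda>i j. N (h i) (h j))"
proof (subst pos_kernel_cong)
  show "pos_kernel J (\<lambda>i j. \<Sum>a\<in>I. \<Sum>b\<in>I. (if a = h i then 1 else 0) * cnj (if b = h j then 1 else 0) * N a b)"
    by (rule pos_kernel_conjugate[OF assms(1)])
  fix i j assume "i \<in> J" "j \<in> J"
  with assms(3) have "h i \<in> I" "h j \<in> I" by auto
  have "(\<Sum>a\<in>I. \<Sum>b\<in>I. (if a = h i then 1 else 0) * cnj (if b = h j then 1 else 0) * N a b)
      = (\<Sum>a\<in>I. if a = h i then (\<Sum>b\<in>I. if b = h j then N a b else 0) else 0)"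
    by (intro sum.cong refl) (auto intro!: sum.cong)
  with \<open>h i \<in> I\<close> \<open>h j \<in> I\<close> assms(2)
  show "N (h i) (h j) = (\<Sum>a\<in>I. \<Sum>b\<in>I. (if a = h i then 1 else 0) * cnj (if b = h j then 1 else 0) * N a b)"
    by simp
qed

section \<open>Order unit and Archimedean property of positive kernels\<close>

lemma sum_diag_form:
  assumes "finite I"
  shows "(\<Sum>i\<in>I. \<Sum>j\<in>I. ((if i = j then of_real r else 0) + N i j) * f j * cnj (f i))
    = of_real (r * (\<Sum>i\<in>I. (cmod (f i))\<^sup>2)) + (\<Sum>i\<in>I. \<Sum>j\<in>I. N i j * f j * cnj (f i))"
proof -
  have "(\<Sum>i\<in>I. \<Sum>j\<in>I. (if i = j then of_real r else 0) * f j * cnj (f i))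
      = (\<Sum>i\<in>I. of_real r * (f i * cnj (f i)))"
    using assms by (simp add: if_distrib[of "\<lambda>x. x * _"] mult.assoc cong: if_cong)
  also have "\<dots> = of_real (r * (\<Sum>i\<in>I. (cmod (f i))\<^sup>2))"
    by (simp only: complex_norm_square[symmetric] sum_distrib_left of_real_sum of_real_mult)
  finally show ?thesis by (simp add: distrib_right sum.distrib)
qed

lemma pos_kernel_diag_add:
  assumes "finite I" and herm: "\<And>i j. i \<in> I \<Longrightarrow> j \<in> I \<Longrightarrow> N i j = cnj (N j i)"
  obtains r :: real where "r > 0" "pos_kernel I (\<lambda>i j. (if i = j then of_real r else 0) + N i j)"
proof
  \<comment> \<open>The sum of the moduli of all entries bounds the form by \<open>R\<close> times
    the squared length of the vector; 1 is added below to have a strictly positive multiple of the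
    unit.\<close>
  define R where "R = (\<Sum>i\<in>I. \<Sum>j\<in>I. cmod (N i j))"
  have "R \<ge> 0" unfolding R_def by (intro sum_nonneg) auto
  then show "R + 1 > 0" by simp
  show "pos_kernel I (\<lambda>i j. (if i = j then of_real (R + 1) else 0) + N i j)"
    unfolding pos_kernel_def sum_diag_form[OF assms(1)]
  proof
    fix f :: "'a \<Rightarrow> complex"
    define q where "q = (\<Sum>i\<in>I. \<Sum>j\<in>I. N i j * f j * cnj (f i))"
    define F where "F = (\<Sum>i\<in>I. (cmod (f i))\<^sup>2)"
    have F: "cmod (f j) * cmod (f i) \<le> F" if "i \<in> I" "j \<in> I" for i j
    proof -
      have "(cmod (f i))\<^sup>2 \<le> F" "(cmod (f j))\<^sup>2 \<le> F"
        unfolding F_def using that assms(1) by (auto intro: member_le_sum)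
      moreover have "2 * (cmod (f j) * cmod (f i)) \<le> (cmod (f i))\<^sup>2 + (cmod (f j))\<^sup>2"
        using sum_squares_bound[of "cmod (f j)" "cmod (f i)"] by simp
      ultimately show ?thesis by simp
    qed
    have "cnj q = (\<Sum>i\<in>I. \<Sum>j\<in>I. cnj (N i j) * cnj (f j) * f i)" by (simp add: q_def)
    also have "\<dots> = (\<Sum>i\<in>I. \<Sum>j\<in>I. N j i * f i * cnj (f j))"
    proof (intro sum.cong refl)
      fix i j assume "i \<in> I" "j \<in> I"
      then have "cnj (N i j) = N j i" using herm by metis
      then show "cnj (N i j) * cnj (f j) * f i = N j i * f i * cnj (f j)" by simp
    qed
    also have "\<dots> = q" unfolding q_def by (rule sum.swap)
    finally have "Im q = 0" by (simp add: complex_eq_iff)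
    have "cmod q \<le> (\<Sum>i\<in>I. \<Sum>j\<in>I. cmod (N i j) * (cmod (f j) * cmod (f i)))"
      unfolding q_def by (intro sum_norm_le) (simp add: norm_mult mult.assoc)
    also have "\<dots> \<le> (\<Sum>i\<in>I. \<Sum>j\<in>I. cmod (N i j) * F)"
      using F by (intro sum_mono mult_left_mono) auto
    also have "\<dots> = R * F" by (simp add: R_def sum_distrib_right)
    finally have "- (R * F) \<le> Re q" using abs_Re_le_cmod[of q] by linarith
    moreover have "F \<ge> 0" unfolding F_def by (intro sum_nonneg) auto
    ultimately have "0 \<le> (R + 1) * F + Re q" by (simp add: algebra_simps)
    then show "0 \<le> of_real ((R + 1) * (\<Sum>i\<in>I. (cmod (f i))\<^sup>2))
        + (\<Sum>i\<in>I. \<Sum>j\<in>I. N i j * f j * cnj (f i))"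
      unfolding q_def[symmetric] F_def[symmetric] using \<open>Im q = 0\<close>
      by (simp add: less_eq_complex_def)
  qed
qed

lemma pos_kernel_archimedean:
  assumes "finite I"
    and pos: "\<And>r::real. r > 0 \<Longrightarrow> pos_kernel I (\<lambda>i j. (if i = j then of_real r else 0) + N i j)"
  shows "pos_kernel I N"
  unfolding pos_kernel_def
proof
  fix f :: "'a \<Rightarrow> complex"
  define q where "q = (\<Sum>i\<in>I. \<Sum>j\<in>I. N i j * f j * cnj (f i))"
  define F where "F = (\<Sum>i\<in>I. (cmod (f i))\<^sup>2)"
  have q: "0 \<le> of_real (r * F) + q" if "r > 0" for r :: real
    using pos[OF that, unfolded pos_kernel_def sum_diag_form[OF assms(1)]]
    by (simp add: q_def F_def)
  have "F \<ge> 0" unfolding F_def by (intro sum_nonneg) auto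
  have "0 \<le> Re q"
  proof (rule field_le_epsilon)
    fix e :: real assume "e > 0"
    \<comment> \<open>The denominator \<open>F + 1\<close> avoids a division by zero when
      \<open>f\<close> vanishes on \<open>I\<close>.\<close>
    have "0 \<le> Re (of_real ((e / (F + 1)) * F) + q)"
      using q[of "e / (F + 1)"] \<open>e > 0\<close> \<open>F \<ge> 0\<close> by (simp add: less_eq_complex_def)
    moreover have "(e / (F + 1)) * F \<le> e" using \<open>e > 0\<close> \<open>F \<ge> 0\<close> by (simp add: field_simps)
    ultimately show "0 \<le> Re q + e" by simp
  qed
  moreover have "Im q = 0" using q[of 1] by (simp add: less_eq_complex_def)
  ultimately show "0 \<le> (\<Sum>i\<in>I. \<Sum>j\<in>I. N i j * f j * cnj (f i))"
    by (simp add: q_def[symmetric] less_eq_complex_def)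
qed

lemma psd_iff_pos_kernel:
  assumes "A \<in> carrier_mat n n"
  shows "psd A \<longleftrightarrow> pos_kernel {..<n} (\<lambda>i j. A $$ (i, j))"
proof -
  have form: "(A *\<^sub>v v) \<bullet>c v = (\<Sum>i<n. \<Sum>j<n. A $$ (i, j) * v $ j * cnj (v $ i))"
    if "v \<in> carrier_vec n" for v
  proof -
    have "(A *\<^sub>v v) \<bullet>c v = (\<Sum>i<n. (\<Sum>j<n. A $$ (i, j) * v $ j) * cnj (v $ i))"
      using assms that by (simp add: scalar_prod_def atLeast0LessThan row_def)
    then show ?thesis by (simp add: sum_distrib_right)
  qed
  show ?thesis
  proof
    assume psd: "psd A"
    show "pos_kernel {..<n} (\<lambda>i j. A $$ (i, j))"
      unfolding pos_kernel_def
    proof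
      fix f :: "nat \<Rightarrow> complex"
      have "0 \<le> (A *\<^sub>v vec n f) \<bullet>c vec n f" using psd assms by (auto simp: psd_def)
      then show "0 \<le> (\<Sum>i<n. \<Sum>j<n. A $$ (i, j) * f j * cnj (f i))" by (simp add: form)
    qed
  next
    assume "pos_kernel {..<n} (\<lambda>i j. A $$ (i, j))"
    then show "psd A" using assms pos_kernelD by (fastforce simp: psd_def form)
  qed
qed

section \<open>Cholesky elimination into sums of rank one kernels\<close>

definition gram :: "('i \<Rightarrow> complex) list \<Rightarrow> 'i \<Rightarrow> 'i \<Rightarrow> complex" where
  "gram L i j = (\<Sum>\<nu>\<leftarrow>L. \<nu> i * cnj (\<nu> j))"

lemma gram_simps [simp]:
  "gram [] i j = 0"
  "gram (\<nu> # L) i j = \<nu> i * cnj (\<nu> j) + gram L i j"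
  by (simp_all add: gram_def)

lemma gram_eq_0:
  assumes "\<forall>\<nu>\<in>set L. \<nu> i = 0 \<or> \<nu> j = 0"
  shows "gram L i j = 0"
  using assms by (induction L) auto

text \<open>One Cholesky step: \<nu> is column \<open>p\<close> divided by the square root of the
  pivot, or 0 if the pivot and hence the column vanish. The last conclusion says that \<nu> is
  supported where the column is; it is the source of the absence of fill-in.\<close>

lemma pos_kernel_eliminate_vector:
  assumes "pos_kernel I N" "finite I" "p \<in> I"
  obtains \<nu> where "pos_kernel I (\<lambda>i j. N i j - \<nu> i * cnj (\<nu> j))"
    "\<And>i. i \<in> I \<Longrightarrow> N i p - \<nu> i * cnj (\<nu> p) = 0"
    "\<And>i. i \<in> I \<Longrightarrow> N i p = 0 \<Longrightarrow> \<nu> i = 0"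
proof (cases "N p p = 0")
  case True
  have "N i p = 0" if "i \<in> I" for i
    using pos_kernel_zero_diag[OF assms that True] pos_kernel_hermitian[OF assms that] by simp
  then show ?thesis using assms by (intro that[of "\<lambda>_. 0"]) auto
next
  case False
  define s where "s = sqrt (Re (N p p))"
  have "0 \<le> N p p" by (rule pos_kernel_diag_nonneg[OF assms])
  then have s: "of_real s * of_real s = N p p" "s \<noteq> 0" using False
    by (auto simp: less_eq_complex_def s_def complex_eq_iff)
  define \<nu> where "\<nu> = (\<lambda>i. N i p / of_real s)"
  have \<nu>: "\<nu> i * cnj (\<nu> j) = N i p * N p j / N p p" if "j \<in> I" for i j
    using pos_kernel_hermitian[OF assms(1,2) that assms(3)] s(1)
    by (simp add: \<nu>_def)
  show ?thesis
  proof
    show "pos_kernel I (\<lambda>i j. N i j - \<nu> i * cnj (\<nu> j))"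
      using pos_kernel_eliminate[OF assms False]
      by (subst pos_kernel_cong[OF _]) (simp_all add: \<nu>)
    show "N i p - \<nu> i * cnj (\<nu> p) = 0" for i
      using False assms(3) by (simp add: \<nu>)
    show "N i p = 0 \<Longrightarrow> \<nu> i = 0" for i by (simp add: \<nu>_def)
  qed
qed

text \<open>Iterated Cholesky steps with the pivots in \<open>J\<close>. The first conjunct tracks
  supports: a row of \<open>N\<close> that is zero on all pivots is never touched.\<close>

lemma pos_kernel_eliminate_set:
  assumes "finite J" "pos_kernel I N" "finite I" "J \<subseteq> I"
  shows "\<exists>L. (\<forall>\<nu>\<in>set L. \<forall>k\<in>I. (\<forall>j\<in>J. N k j = 0) \<longrightarrow> \<nu> k = 0)
    \<and> pos_kernel I (\<lambda>i j. N i j - gram L i j)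
    \<and> (\<forall>j\<in>J. \<forall>i\<in>I. N i j - gram L i j = 0)"
  using assms
proof (induction J arbitrary: N rule: finite_induct)
  case empty
  then show ?case by (intro exI[of _ "[]"]) simp
next
  case (insert p J)
  then have p: "p \<in> I" by simp
  obtain \<nu> where \<nu>: "pos_kernel I (\<lambda>i j. N i j - \<nu> i * cnj (\<nu> j))"
    "\<And>i. i \<in> I \<Longrightarrow> N i p - \<nu> i * cnj (\<nu> p) = 0"
    "\<And>i. i \<in> I \<Longrightarrow> N i p = 0 \<Longrightarrow> \<nu> i = 0"
    using pos_kernel_eliminate_vector[OF insert.prems(1,2) p] by blast
  define N' where "N' = (\<lambda>i j. N i j - \<nu> i * cnj (\<nu> j))"
  have N': "pos_kernel I N'" unfolding N'_def by (rule \<nu>(1))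
  have col: "N' i p = 0" if "i \<in> I" for i using \<nu>(2)[OF that] by (simp add: N'_def)
  have row: "N' p i = 0" if "i \<in> I" for i
    using pos_kernel_hermitian[OF N' insert.prems(2) that p] col[OF that] by simp
  obtain L where L: "\<forall>\<nu>\<in>set L. \<forall>k\<in>I. (\<forall>j\<in>J. N' k j = 0) \<longrightarrow> \<nu> k = 0"
    "pos_kernel I (\<lambda>i j. N' i j - gram L i j)"
    "\<forall>j\<in>J. \<forall>i\<in>I. N' i j - gram L i j = 0"
    using insert.IH[OF N'] insert.prems by auto
  \<comment> \<open>Row \<open>p\<close> is already zero, so later vectors vanish at
    \<open>p\<close> and column \<open>p\<close> stays eliminated.\<close>
  have Lp: "\<mu> p = 0" if "\<mu> \<in> set L" for \<mu>
    using L(1) that row p insert.prems(3) by auto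
  have eq: "N i j - gram (\<nu> # L) i j = N' i j - gram L i j" for i j
    by (simp add: N'_def)
  \<comment> \<open>Since \<nu> vanishes at \<open>k\<close>, row \<open>k\<close> agrees in
    \<open>N\<close> and \<open>N'\<close>, and the induction hypothesis applies to it.\<close>
  have "\<mu> k = 0" if "\<mu> \<in> set (\<nu> # L)" "k \<in> I" "\<forall>j\<in>insert p J. N k j = 0" for \<mu> k
  proof -
    have "\<nu> k = 0" using \<nu>(3) that by simp
    then show ?thesis using L(1) that by (auto simp: N'_def)
  qed
  moreover have "N' i p - gram L i p = 0" if "i \<in> I" for i
    using Lp by (simp add: col[OF that] gram_eq_0)
  ultimately show ?case using L(2,3) by (intro exI[of _ "\<nu> # L"]) (simp only: eq, blast)
qed

text \<open>Cholesky decomposition, starting with the indices in \<open>J\<close>: no fill-in occurs in the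
  block of zeros.\<close>

lemma pos_kernel_decomposition:
  assumes "pos_kernel I N" "finite I" "J \<subseteq> I" "K \<subseteq> I"
    and zero: "\<And>k j. k \<in> K \<Longrightarrow> j \<in> J \<Longrightarrow> N k j = 0"
  obtains L M where "\<And>\<nu> k. \<nu> \<in> set L \<Longrightarrow> k \<in> K \<Longrightarrow> \<nu> k = 0"
    "\<And>\<nu> j. \<nu> \<in> set M \<Longrightarrow> j \<in> J \<Longrightarrow> \<nu> j = 0"
    "\<And>i j. i \<in> I \<Longrightarrow> j \<in> I \<Longrightarrow> N i j = gram L i j + gram M i j"
proof -
  have "finite J" using assms(2,3) finite_subset by blast
  from pos_kernel_eliminate_set[OF this assms(1-3)] obtain L where
    L: "\<forall>\<nu>\<in>set L. \<forall>k\<in>I. (\<forall>j\<in>J. N k j = 0) \<longrightarrow> \<nu> k = 0"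
      "pos_kernel I (\<lambda>i j. N i j - gram L i j)" "\<forall>j\<in>J. \<forall>i\<in>I. N i j - gram L i j = 0"
    by blast
  \<comment> \<open>Eliminating all indices from the remainder leaves zero, so the two Gram sums add
    up to \<open>N\<close>.\<close>
  from pos_kernel_eliminate_set[OF assms(2) L(2) assms(2) order_refl] obtain M where
    M: "\<forall>\<nu>\<in>set M. \<forall>k\<in>I. (\<forall>j\<in>I. N k j - gram L k j = 0) \<longrightarrow> \<nu> k = 0"
      "\<forall>j\<in>I. \<forall>i\<in>I. N i j - gram L i j - gram M i j = 0"
    by blast
  show ?thesis
  proof
    show "\<nu> k = 0" if "\<nu> \<in> set L" "k \<in> K" for \<nu> k
      using L(1) that zero assms(4) by auto
    show "\<nu> j = 0" if "\<nu> \<in> set M" "j \<in> J" for \<nu> j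
    proof -
      \<comment> \<open>The first elimination cleared the columns in \<open>J\<close>, hence by
        symmetry the rows; the second one therefore does not touch them.\<close>
      have "N j i - gram L j i = 0" if "i \<in> I" for i
        using pos_kernel_hermitian[OF L(2) assms(2), of i j] L(3) that \<open>j \<in> J\<close> assms(3) by auto
      then show ?thesis using M(1) that assms(3) by blast
    qed
    show "N i j = gram L i j + gram M i j" if "i \<in> I" "j \<in> I" for i j
      using M(2) that by (simp add: algebra_simps)
  qed
qed

section \<open>The dual system\<close>

lemma scaleC_fun_apply [simp]: "(c *\<^sub>C f) x = c *\<^sub>C f x"
  by (simp add: scaleC_fun_def)

lemma scaleC_complex [simp]: "c *\<^sub>C (z :: complex) = c * z"
  by (simp add: scaleC_complex_def)

text \<open>The entries of the $3 \times 3$ matrix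
  $\begin{pmatrix} f_0 & f_1 & f_2 \cr f_3 & f_0 & 0 \cr f_4 & 0 & f_0 \end{pmatrix}$.\<close>

definition arrow :: "(nat \<Rightarrow> 'a :: zero) \<Rightarrow> nat \<Rightarrow> nat \<Rightarrow> 'a" where
  "arrow f s t = (if s = t then f 0 else if s = 0 then f t else if t = 0 then f (s + 2) else 0)"

text \<open>The coordinates 0 to 4 are the coefficients of I, E_01, E_02, E_10, E_20; requiring
  zeros beyond makes the representation unique.\<close>

definition arrow_space :: "(nat \<Rightarrow> complex) set" where
  "arrow_space = {f. \<forall>l\<ge>5. f l = 0}"

text \<open>The conjugate transpose: it exchanges the coordinates 1 and 3, and 2 and 4.\<close>

definition arrow_star :: "(nat \<Rightarrow> complex) \<Rightarrow> nat \<Rightarrow> complex" where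
  "arrow_star f l = cnj (f (if l \<in> {1, 2} then l + 2 else if l \<in> {3, 4} then l - 2 else l))"

definition coord :: "nat \<Rightarrow> nat \<Rightarrow> complex" where
  "coord l = (\<lambda>k. if k = l then 1 else 0)"

text \<open>A matrix over the arrow system read as a scalar matrix in M_p(M_3), with the outer index
  as first component of the pair.\<close>

definition arrow_kernel :: "(nat \<Rightarrow> complex) mat \<Rightarrow> nat \<times> nat \<Rightarrow> nat \<times> nat \<Rightarrow> complex" where
  "arrow_kernel A x y = arrow (A $$ (fst x, fst y)) (snd x) (snd y)"

abbreviation arrow_index :: "nat \<Rightarrow> (nat \<times> nat) set" where
  "arrow_index p \<equiv> {..<p} \<times> {..<3}"

definition arrow_system :: "(nat \<Rightarrow> complex) opsys" where
  "arrow_system = \<lparr>os_space = arrow_space, os_star = arrow_star, os_unit = coord 0,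
    os_cone = (\<lambda>p. {A \<in> mats p arrow_space. pos_kernel (arrow_index p) (arrow_kernel A)})\<rparr>"

lemma arrow_system_simps [simp]:
  "os_space arrow_system = arrow_space"
  "os_star arrow_system = arrow_star"
  "os_unit arrow_system = coord 0"
  "os_cone arrow_system p = {A \<in> mats p arrow_space. pos_kernel (arrow_index p) (arrow_kernel A)}"
  by (simp_all add: arrow_system_def)

lemma subspace_arrow_space: "cvec.subspace arrow_space"
  by (auto simp: cvec.subspace_def arrow_space_def)

lemma coord_arrow_space: "l < 5 \<Longrightarrow> coord l \<in> arrow_space"
  by (simp add: arrow_space_def coord_def)

lemma less_3_cases: "(s::nat) < 3 \<longleftrightarrow> s = 0 \<or> s = 1 \<or> s = 2"
  by auto

lemma less_5_cases: "(l::nat) < 5 \<longleftrightarrow> l = 0 \<or> l = 1 \<or> l = 2 \<or> l = 3 \<or> l = 4"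
  by auto

lemma arrow_arrow_star: "s < 3 \<Longrightarrow> t < 3 \<Longrightarrow> arrow (arrow_star f) s t = cnj (arrow f t s)"
  by (auto simp: less_3_cases arrow_def arrow_star_def)

text \<open>Brings equations between kernels back to the coordinates, which all appear in the first
  row and the first column.\<close>

lemma arrow_space_eqI:
  assumes "f \<in> arrow_space" "g \<in> arrow_space"
    and eq: "\<And>s t. s < 3 \<Longrightarrow> t < 3 \<Longrightarrow> arrow f s t = arrow g s t"
  shows "f = g"
proof
  fix l
  show "f l = g l"
  proof (cases "l < 5")
    case True
    then consider "l = 0" | "l = 1" | "l = 2" | "l = 1 + 2" | "l = 2 + 2" by linarith
    then show ?thesis using eq[of 0 0] eq[of 0 1] eq[of 0 2] eq[of 1 0] eq[of 2 0]
      by cases (simp_all add: arrow_def)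
  qed (use assms(1,2) in \<open>simp add: arrow_space_def\<close>)
qed

lemma arrow_simps [simp]:
  fixes f g :: "nat \<Rightarrow> complex"
  shows "arrow 0 s t = (0 :: complex)"
    "arrow (f + g) s t = arrow f s t + arrow g s t"
    "arrow (- f) s t = - arrow f s t"
    "arrow (c *\<^sub>C f) s t = c * arrow f s t"
    "arrow (coord 0) s t = (if s = t then 1 else 0)"
  by (simp_all add: arrow_def coord_def)

lemma arrow_entries:
  "arrow f 0 0 = f 0" "arrow f 0 (Suc 0) = f (Suc 0)" "arrow f (Suc 0) 0 = f 3"
  "arrow f (Suc 0) (Suc 0) = f 0" "arrow f 0 2 = f 2" "arrow f 2 0 = f 4" "arrow f 2 2 = f 0"
  by (simp_all add: arrow_def eval_nat_numeral)

lemma arrow_sum: "arrow (sum f I) s t = (\<Sum>i\<in>I. arrow (f i) s t :: complex)"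
  by (induction I rule: infinite_finite_induct)
    (simp_all only: sum.infinite sum.empty sum.insert arrow_simps simp_thms)

lemma arrow_if: "arrow (if b then f else g) s t = (if b then arrow f s t else arrow g s t)"
  by simp

section \<open>The operator system axioms for the arrow system\<close>

lemma arrow_kernel_hermitian:
  assumes "A \<in> mats p arrow_space" "pos_kernel (arrow_index p) (arrow_kernel A)" "i < p" "j < p"
  shows "A $$ (i, j) = arrow_star (A $$ (j, i))"
proof (rule arrow_space_eqI)
  show "A $$ (i, j) \<in> arrow_space" using assms by (simp add: mats_def)
  show "arrow_star (A $$ (j, i)) \<in> arrow_space"
    using assms by (auto simp: mats_def arrow_space_def arrow_star_def)
  fix s t :: nat assume "s < 3" "t < 3"
  then show "arrow (A $$ (i, j)) s t = arrow (arrow_star (A $$ (j, i))) s t"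
    using pos_kernel_hermitian[OF assms(2), of "(j, t)" "(i, s)"] assms(3,4)
    by (simp add: arrow_kernel_def arrow_arrow_star)
qed

lemma arrow_kernel_diag_add:
  assumes "A \<in> mats p arrow_space" "x \<in> arrow_index p" "y \<in> arrow_index p"
  shows "arrow_kernel (diag p (c *\<^sub>C coord 0) + A) x y = (if x = y then c else 0) + arrow_kernel A x y"
  using assms by (auto simp: arrow_kernel_def mats_def diag_def arrow_if split: if_splits)

lemma diag_add_mats:
  assumes "cvec.subspace V" "e \<in> V" "A \<in> mats p V"
  shows "diag p (c *\<^sub>C e) + A \<in> mats p V"
  using assms cvec.subspace_0[OF assms(1)]
  by (auto simp: mats_def diag_def intro!: cvec.subspace_add cvec.subspace_scale)

text \<open>At the level of M_p(M_3), conjugation by \<open>X\<close> is conjugation by X \<otimes>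
  I_3.\<close>

lemma arrow_kernel_conjugation:
  assumes "A \<in> carrier_mat p p" "X \<in> carrier_mat q p" "x \<in> arrow_index q" "y \<in> arrow_index q"
  shows "arrow_kernel (conjugation X A) x y =
    (\<Sum>a\<in>arrow_index p. \<Sum>b\<in>arrow_index p. (if snd x = snd a then X $$ (fst x, fst a) else 0) *
      cnj (if snd y = snd b then X $$ (fst y, fst b) else 0) * arrow_kernel A a b)"
proof -
  obtain i s j t where xy: "x = (i, s)" "y = (j, t)" "i < q" "s < 3" "j < q" "t < 3"
    using assms(3,4) by auto
  \<comment> \<open>The factor I_3 leaves only the pairs whose second component is
    \<open>s\<close>.\<close>
  have collapse: "(\<Sum>a\<in>arrow_index p. g a) = (\<Sum>a<p. g (a, s))"
    if "s < 3" "\<And>a u. u \<noteq> s \<Longrightarrow> g (a, u) = 0" for g :: "nat \<times> nat \<Rightarrow> complex" and s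
  proof -
    have "(\<Sum>a\<in>arrow_index p. g a) = (\<Sum>a<p. \<Sum>u<3. g (a, u))"
      by (simp add: sum.cartesian_product)
    also have "\<dots> = (\<Sum>a<p. \<Sum>u\<in>{s}. g (a, u))"
      using that by (intro sum.cong refl sum.mono_neutral_right) auto
    finally show ?thesis by simp
  qed
  have "arrow_kernel (conjugation X A) x y
      = (\<Sum>a<p. \<Sum>b<p. X $$ (i, a) * cnj (X $$ (j, b)) * arrow_kernel A (a, s) (b, t))"
    using assms(1,2) xy by (simp add: arrow_kernel_def conjugation_def arrow_sum)
  then show ?thesis using xy
    by (simp add: collapse[of s] collapse[of t])
qed

lemma conjugation_mats:
  assumes "cvec.subspace V" "A \<in> mats p V" "X \<in> carrier_mat q p"
  shows "conjugation X A \<in> mats q V"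
  using assms
  by (auto simp: mats_def conjugation_def intro!: cvec.subspace_sum cvec.subspace_scale)

lemma operator_system_arrow_system: "operator_system arrow_system"
  unfolding operator_system_def arrow_system_simps
proof (intro conjI allI ballI impI subsetI CollectI)
  show "cvec.subspace arrow_space" by (rule subspace_arrow_space)
  show "arrow_star x \<in> arrow_space" if "x \<in> arrow_space" for x
    using that by (auto simp: arrow_space_def arrow_star_def)
  show "arrow_star (arrow_star x) = x" if "x \<in> arrow_space" for x
    by (rule ext) (auto simp: arrow_star_def eval_nat_numeral)
  show "arrow_star (x + y) = arrow_star x + arrow_star y" for x y
    by (rule ext) (simp add: arrow_star_def)
  show "arrow_star (c *\<^sub>C x) = cnj c *\<^sub>C arrow_star x" for c x
    by (rule ext) (simp add: arrow_star_def)
  show "coord 0 \<in> arrow_space" by (simp add: coord_arrow_space)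
  show "arrow_star (coord 0) = coord 0"
    by (rule ext) (simp add: arrow_star_def coord_def)
next
  fix p A
  assume A: "A \<in> {A \<in> mats p arrow_space. pos_kernel (arrow_index p) (arrow_kernel A)}"
  then show "A \<in> hermitian_mats arrow_system p"
    by (auto simp: hermitian_mats_def intro: arrow_kernel_hermitian)
  fix B
  assume B: "B \<in> {A \<in> mats p arrow_space. pos_kernel (arrow_index p) (arrow_kernel A)}"
  show "A + B \<in> mats p arrow_space"
    using A B by (auto simp: mats_def intro!: cvec.subspace_add[OF subspace_arrow_space])
  show "pos_kernel (arrow_index p) (arrow_kernel (A + B))"
  proof (subst pos_kernel_cong)
    show "pos_kernel (arrow_index p) (\<lambda>x y. arrow_kernel A x y + arrow_kernel B x y)"
      using A B by (simp add: pos_kernel_add)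
  qed (use A B in \<open>auto simp: arrow_kernel_def mats_def\<close>)
next
  fix p q A and X :: "complex mat"
  assume A: "A \<in> {A \<in> mats p arrow_space. pos_kernel (arrow_index p) (arrow_kernel A)}"
    and X: "X \<in> carrier_mat q p"
  show "conjugation X A \<in> mats q arrow_space"
    using A X by (auto intro: conjugation_mats subspace_arrow_space)
  have carrier: "A \<in> carrier_mat p p" using A by (simp add: mats_def)
  have "pos_kernel (arrow_index q) (\<lambda>x y.
    \<Sum>a\<in>arrow_index p. \<Sum>b\<in>arrow_index p. (if snd x = snd a then X $$ (fst x, fst a) else 0) *
      cnj (if snd y = snd b then X $$ (fst y, fst b) else 0) * arrow_kernel A a b)"
    using A by (intro pos_kernel_conjugate) simp
  then show "pos_kernel (arrow_index q) (arrow_kernel (conjugation X A))"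
    by (subst pos_kernel_cong[OF arrow_kernel_conjugation[OF carrier X]])
next
  fix p A
  assume A: "A \<in> {A \<in> mats p arrow_space. pos_kernel (arrow_index p) (arrow_kernel A)}"
    and mA: "- A \<in> {A \<in> mats p arrow_space. pos_kernel (arrow_index p) (arrow_kernel A)}"
  have carrier: "A \<in> carrier_mat p p" using A by (simp add: mats_def)
  have neg: "arrow_kernel (- A) x y = - arrow_kernel A x y"
    if "x \<in> arrow_index p" "y \<in> arrow_index p" for x y
    using that carrier by (auto simp: arrow_kernel_def)
  \<comment> \<open>Positivity of \<open>A\<close> and \<open>- A\<close> makes the diagonal zero,
    which forces all entries to be zero.\<close>
  have zero: "arrow_kernel A x y = 0" if "x \<in> arrow_index p" "y \<in> arrow_index p" for x y
  proof (rule pos_kernel_zero_diag[OF _ _ that])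
    show "pos_kernel (arrow_index p) (arrow_kernel A)" using A by simp
    have "0 \<le> arrow_kernel A x x"
      using A that by (intro pos_kernel_diag_nonneg) auto
    moreover have "0 \<le> arrow_kernel (- A) x x"
      using mA that by (intro pos_kernel_diag_nonneg) auto
    ultimately show "arrow_kernel A x x = 0"
      using that by (simp add: neg)
  qed simp
  show "A = 0\<^sub>m p p"
  proof (rule eq_matI)
    fix i j assume "i < dim_row (0\<^sub>m p p)" "j < dim_col (0\<^sub>m p p)"
    then have ij: "i < p" "j < p" by simp_all
    have "A $$ (i, j) = 0"
    proof (rule arrow_space_eqI)
      show "A $$ (i, j) \<in> arrow_space" using A ij by (simp add: mats_def)
      show "0 \<in> arrow_space" by (simp add: arrow_space_def)
      show "arrow (A $$ (i, j)) s t = arrow 0 s t" if "s < 3" "t < 3" for s t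
        using zero[of "(i, s)" "(j, t)"] ij that by (simp add: arrow_kernel_def)
    qed
    then show "A $$ (i, j) = 0\<^sub>m p p $$ (i, j)" using ij by simp
  qed (use carrier in auto)
next
  fix p A
  assume A: "A \<in> hermitian_mats arrow_system p"
  then have mats: "A \<in> mats p arrow_space" by (simp add: hermitian_mats_def)
  have herm: "arrow_kernel A x y = cnj (arrow_kernel A y x)"
    if "x \<in> arrow_index p" "y \<in> arrow_index p" for x y
  proof -
    have lt: "fst x < p" "fst y < p" "snd x < 3" "snd y < 3" using that by auto
    then have eq: "A $$ (fst x, fst y) = arrow_star (A $$ (fst y, fst x))"
      using A unfolding hermitian_mats_def arrow_system_simps by blast
    show ?thesis unfolding arrow_kernel_def eq using lt(3,4) by (rule arrow_arrow_star)
  qed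
  have finite: "finite (arrow_index p)" by simp
  obtain r :: real where r: "r > 0"
    "pos_kernel (arrow_index p) (\<lambda>x y. (if x = y then of_real r else 0) + arrow_kernel A x y)"
    by (rule pos_kernel_diag_add[OF finite herm])
  have "pos_kernel (arrow_index p) (arrow_kernel (diag p (complex_of_real r *\<^sub>C coord 0) + A))"
    using r(2) by (subst pos_kernel_cong[OF arrow_kernel_diag_add[OF mats]])
  then show "\<exists>r::real. r > 0 \<and> diag p (complex_of_real r *\<^sub>C coord 0) + A
      \<in> {A \<in> mats p arrow_space. pos_kernel (arrow_index p) (arrow_kernel A)}"
    using r(1) diag_add_mats[OF subspace_arrow_space coord_arrow_space mats] by auto
next
  fix p A
  assume mats: "A \<in> mats p arrow_space"
    and pos: "\<forall>\<epsilon>::real. \<epsilon> > 0 \<longrightarrow> diag p (complex_of_real \<epsilon> *\<^sub>C coord 0) + A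
      \<in> {A \<in> mats p arrow_space. pos_kernel (arrow_index p) (arrow_kernel A)}"
  show "A \<in> mats p arrow_space" by (rule mats)
  show "pos_kernel (arrow_index p) (arrow_kernel A)"
  proof (rule pos_kernel_archimedean)
    fix r :: real assume "r > 0"
    with pos have "pos_kernel (arrow_index p) (arrow_kernel (diag p (complex_of_real r *\<^sub>C coord 0) + A))"
      by blast
    then show "pos_kernel (arrow_index p) (\<lambda>x y. (if x = y then of_real r else 0) + arrow_kernel A x y)"
      by (subst (asm) pos_kernel_cong[OF arrow_kernel_diag_add[OF mats]])
  qed simp
qed

section \<open>Tensor products\<close>

lemma linear_into_mats_sum:
  assumes \<phi>: "linear_into_mats V k \<phi>" and V: "cvec.subspace V" and I: "finite I" "\<And>l. l \<in> I \<Longrightarrow> x l \<in> V"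
    and ij: "i < k" "j < k"
  shows "\<phi> (\<Sum>l\<in>I. c l *\<^sub>C x l) $$ (i, j) = (\<Sum>l\<in>I. c l * \<phi> (x l) $$ (i, j))"
  using I
proof (induction I rule: finite_induct)
  case empty
  have "0 \<in> V" using V by (rule cvec.subspace_0)
  then have "\<phi> (0 *\<^sub>C 0) = 0 \<cdot>\<^sub>m \<phi> 0" "\<phi> 0 \<in> carrier_mat k k"
    using \<phi> unfolding linear_into_mats_def by blast+
  then have "\<phi> 0 = 0 \<cdot>\<^sub>m \<phi> 0" "\<phi> 0 \<in> carrier_mat k k" by simp_all
  then have "\<phi> 0 $$ (i, j) = 0" using ij by (metis carrier_matD index_smult_mat(1) mult_zero_left)
  then show ?case by simp
next
  case (insert p I)
  have mem: "c p *\<^sub>C x p \<in> V" "(\<Sum>l\<in>I. c l *\<^sub>C x l) \<in> V" "x p \<in> V"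
    using insert.prems V by (auto intro!: cvec.subspace_sum cvec.subspace_scale)
  then have "\<phi> (c p *\<^sub>C x p + (\<Sum>l\<in>I. c l *\<^sub>C x l)) = c p \<cdot>\<^sub>m \<phi> (x p) + \<phi> (\<Sum>l\<in>I. c l *\<^sub>C x l)"
    and "\<phi> (x p) \<in> carrier_mat k k" "\<phi> (\<Sum>l\<in>I. c l *\<^sub>C x l) \<in> carrier_mat k k"
    using \<phi> by (auto simp: linear_into_mats_def)
  then show ?case using insert ij by simp
qed

lemma linear_into_mats_zero:
  assumes "linear_into_mats V k \<phi>" "cvec.subspace V" "i < k" "j < k"
  shows "\<phi> 0 $$ (i, j) = 0"
  using linear_into_mats_sum[OF assms(1,2), of "{}"] assms(3,4) by simp

lemma arrow_space_expand:
  assumes "f \<in> arrow_space"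
  shows "f = (\<Sum>l<5. f l *\<^sub>C coord l)"
proof
  fix k
  have "(\<Sum>l<5. f l * (if k = l then 1 else 0)) = (if k < 5 then f k else 0)"
    by (simp add: if_distrib[of "\<lambda>x. _ * x"] cong: if_cong)
  then show "f k = (\<Sum>l<5. f l *\<^sub>C coord l) k"
    using assms by (simp add: sum_fun_apply coord_def arrow_space_def)
qed

lemma sum_lessThan_3: "(\<Sum>i<3. f i) = f 0 + (f 1 + f (2::nat))"
  by (simp add: numeral_3_eq_3 numeral_2_eq_2 add.assoc)

lemma amplify_carrier: "amplify p k \<phi> A \<in> carrier_mat (p * k) (p * k)"
  by (simp add: amplify_def)

text \<open>Elementary tensors take the default value 0 at functions that are not bilinear. The
  entries of \<phi> \<otimes> \<psi> must be known to be bilinear before a tensor can be evaluated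
  there.\<close>

lemma bilinear_form_prod:
  assumes "linear_into_mats V k \<phi>" "linear_into_mats W m \<psi>" "i < k" "i' < k" "j < m" "j' < m"
  shows "(\<lambda>x y. \<phi> x $$ (i, i') * \<psi> y $$ (j, j')) \<in> bilinear_forms V W"
proof -
  have "\<phi> (x + x') $$ (i, i') = \<phi> x $$ (i, i') + \<phi> x' $$ (i, i')" if "x \<in> V" "x' \<in> V" for x x'
  proof -
    have "\<phi> (x + x') = \<phi> x + \<phi> x'" "\<phi> x \<in> carrier_mat k k" "\<phi> x' \<in> carrier_mat k k"
      using assms(1) that by (auto simp: linear_into_mats_def)
    then show ?thesis using assms(3,4) by simp
  qed
  moreover have "\<phi> (c *\<^sub>C x) $$ (i, i') = c * \<phi> x $$ (i, i')" if "x \<in> V" for c x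
  proof -
    have "\<phi> (c *\<^sub>C x) = c \<cdot>\<^sub>m \<phi> x" "\<phi> x \<in> carrier_mat k k"
      using assms(1) that by (auto simp: linear_into_mats_def)
    then show ?thesis using assms(3,4) by simp
  qed
  moreover have "\<psi> (x + x') $$ (j, j') = \<psi> x $$ (j, j') + \<psi> x' $$ (j, j')" if "x \<in> W" "x' \<in> W" for x x'
  proof -
    have "\<psi> (x + x') = \<psi> x + \<psi> x'" "\<psi> x \<in> carrier_mat m m" "\<psi> x' \<in> carrier_mat m m"
      using assms(2) that by (auto simp: linear_into_mats_def)
    then show ?thesis using assms(5,6) by simp
  qed
  moreover have "\<psi> (c *\<^sub>C x) $$ (j, j') = c * \<psi> x $$ (j, j')" if "x \<in> W" for c x
  proof -
    have "\<psi> (c *\<^sub>C x) = c \<cdot>\<^sub>m \<psi> x" "\<psi> x \<in> carrier_mat m m"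
      using assms(2) that by (auto simp: linear_into_mats_def)
    then show ?thesis using assms(5,6) by simp
  qed
  ultimately show ?thesis by (simp add: bilinear_forms_def distrib_left distrib_right mult_ac)
qed

section \<open>The operator system spanned by the Cuntz isometries\<close>

locale cuntz =
  fixes n :: enat and S :: "nat \<Rightarrow> 'h \<Rightarrow> 'h :: chilbert_space"
  assumes n: "2 \<le> n" and S: "cuntz_isometries n S"
begin

text \<open>The elements of the Cuntz system that are matched with the coordinates 0 to 4 of the
  arrow system; \<open>S 0\<close> and \<open>S 1\<close> are the isometries S_1 and S_2.\<close>

definition gen :: "nat \<Rightarrow> 'h \<Rightarrow> 'h" where
  "gen l = [id, S 0, S 1, adj (S 0), adj (S 1)] ! l"

lemma gen_simps [simp]:
  "gen 0 = id" "gen (Suc 0) = S 0" "gen 2 = S 1" "gen 3 = adj (S 0)" "gen 4 = adj (S 1)"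
  by (simp_all add: gen_def eval_nat_numeral)

lemma less_n: "enat 0 < n" "enat 1 < n"
  using n by (auto simp: numeral_eq_enat intro: less_le_trans[of _ "enat 2"])

lemma isometry: "enat i < n \<Longrightarrow> hilbert_isometry (S i)"
  using S by (simp add: cuntz_isometries_def hilbert_isometry_def)

sublocale S0: hilbert_isometry "S 0"
  using isometry less_n by simp

sublocale S1: hilbert_isometry "S (Suc 0)"
  using isometry less_n by simp

lemma orthogonal: "enat i < n \<Longrightarrow> enat j < n \<Longrightarrow> i \<noteq> j \<Longrightarrow> cinner (S i x) (S j y) = 0"
  using cuntz_isometries_orthogonal[OF S] .

definition V :: "('h \<Rightarrow> 'h) set" where
  "V = cvec.span ({id} \<union> {S i |i. enat i < n} \<union> {adj (S i) |i. enat i < n})"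

lemma cuntz_system_simps [simp]:
  "os_space (cuntz_system n S) = V"
  "os_star (cuntz_system n S) = adj"
  "os_unit (cuntz_system n S) = id"
  "os_cone (cuntz_system n S) p = {A \<in> mats p V. op_mat_pos A}"
  by (simp_all add: cuntz_system_def concrete_system_def V_def)

lemma subspace_V: "cvec.subspace V"
  by (simp add: V_def)

text \<open>Induction along a linear combination, so that properties linear in \<open>B\<close> are
  checked on the generators.\<close>

lemma V_cases [consumes 1, case_names zero id S adj]:
  assumes "B \<in> V" and "P 0"
    and "\<And>c B. P B \<Longrightarrow> P (c *\<^sub>C id + B)"
    and "\<And>c i B. enat i < n \<Longrightarrow> P B \<Longrightarrow> P (c *\<^sub>C S i + B)"
    and "\<And>c i B. enat i < n \<Longrightarrow> P B \<Longrightarrow> P (c *\<^sub>C adj (S i) + B)"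
  shows "P B"
  using assms(1) unfolding V_def by (induction rule: cvec.span_induct_alt) (use assms(2-5) in blast)+

lemma V_linear:
  assumes "B \<in> V"
  shows "B (x + y) = B x + B y" "B (c *\<^sub>C x) = c *\<^sub>C B x"
proof -
  have "B (x + y) = B x + B y \<and> B (c *\<^sub>C x) = c *\<^sub>C B x"
    using assms
  proof (induction rule: V_cases)
    case (S d i B)
    interpret hilbert_isometry "S i" using isometry S by simp
    show ?case using S by (simp add: add scaleC scaleC_add_right scaleC_scaleC mult.commute)
  next
    case (adj d i B)
    interpret hilbert_isometry "S i" using isometry adj by simp
    show ?case using adj
      by (simp add: adj_add adj_scaleC scaleC_add_right scaleC_scaleC mult.commute)
  qed (simp_all add: scaleC_add_right scaleC_scaleC mult.commute)
  then show "B (x + y) = B x + B y" "B (c *\<^sub>C x) = c *\<^sub>C B x" by auto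
qed

lemma V_sum:
  assumes "B \<in> V"
  shows "B (sum f I) = (\<Sum>i\<in>I. B (f i))"
proof -
  have "B 0 = 0" using V_linear(2)[OF assms, of 0 0] by simp
  then show ?thesis
    by (induction I rule: infinite_finite_induct) (simp_all add: V_linear[OF assms])
qed

text \<open>On products $S_i S_j x$ with $i \neq j$ only the coefficient of \<open>id\<close> contributes.\<close>

lemma V_swap:
  assumes "B \<in> V"
  shows "cinner (B (S 1 (S 0 x))) (S 1 (S 0 x)) = cinner (B (S 0 (S 1 x))) (S 0 (S 1 x))"
  using assms
proof (induction rule: V_cases)
  case (S d i B)
  \<comment> \<open>If \<open>i = j\<close>, cancelling the outer isometry leaves \<open>S j\<close>
    against \<open>S k\<close>; otherwise the outer ranges of \<open>S i\<close> and
    \<open>S j\<close> are orthogonal.\<close>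
  have "cinner (S i (S j (S k x))) (S j (S k x)) = 0"
    if "enat j < n" "enat k < n" "j \<noteq> k" for j k
  proof (cases "i = j")
    case True
    interpret hilbert_isometry "S j" using isometry that by simp
    show ?thesis using orthogonal[OF that] True by (simp add: cinner_eq)
  qed (use orthogonal S that in simp)
  from this[OF less_n] this[OF less_n(2,1)] S show ?case
    by (simp add: cinner_simps)
next
  case (adj d i B)
  interpret hilbert_isometry "S i" using isometry adj by simp
  \<comment> \<open>If \<open>i = j\<close>, the adjoint cancels \<open>S j\<close> and leaves
    \<open>S k\<close> against \<open>S j\<close>; otherwise it moves to the right and meets the
    orthogonal range of \<open>S j\<close>.\<close>
  have "cinner (adj (S i) (S j (S k x))) (S j (S k x)) = 0"
    if "enat j < n" "enat k < n" "j \<noteq> k" for j k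
  proof (cases "i = j")
    case True
    show ?thesis using orthogonal[of k j] that by (simp add: adj_cancel True[symmetric])
  next
    case False
    then show ?thesis using orthogonal[of j i] adj that by (simp add: cinner_adj_left)
  qed
  from this[OF less_n] this[OF less_n(2,1)] adj show ?case
    by (simp add: cinner_simps)
qed (simp_all add: cinner_simps S0.cinner_eq S1.cinner_eq)

section \<open>The element \<open>u\<close> and its positivity in the minimal tensor product\<close>

lemma gen_V: "l < 5 \<Longrightarrow> gen l \<in> V"
  using less_n unfolding V_def by (intro cvec.span_base) (auto simp: less_5_cases)

definition u :: "('h \<Rightarrow> 'h, nat \<Rightarrow> complex) tensor" where
  "u = (\<Sum>l<5. elem_tensor (cuntz_system n S) arrow_system (gen l) (coord l))"

lemma u_apply: "\<beta> \<in> bilinear_forms V arrow_space \<Longrightarrow> u \<beta> = (\<Sum>l<5. \<beta> (gen l) (coord l))"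
  by (simp add: u_def sum_fun_apply elem_tensor_def)

lemma u_tensor_space: "u \<in> tensor_space (cuntz_system n S) arrow_system"
  unfolding u_def tensor_space_def
  by (intro cvec.span_sum cvec.span_base) (use gen_V coord_arrow_space in fastforce)

definition W :: "('h \<Rightarrow> 'h) mat" where
  "W = mat 3 3 (\<lambda>(s, t). arrow gen s t)"

text \<open>\<open>W\<close> equals R^* R for the row R = (1, S_1, S_2), because the isometries have
  orthogonal ranges; its form is the squared norm of the image under R.\<close>

lemma W_cone: "W \<in> os_cone (cuntz_system n S) 3"
proof -
  have "arrow gen s t \<in> V" if "s < 3" "t < 3" for s t
    using that cvec.subspace_0[OF subspace_V] by (auto simp: arrow_def intro: gen_V simp del: gen_simps)
  then have "W \<in> mats 3 V" by (simp add: mats_def W_def)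
  moreover have "op_mat_pos W"
    unfolding op_mat_pos_def
  proof (intro conjI allI)
    fix \<xi> :: "nat \<Rightarrow> 'h"
    let ?v = "\<xi> 0 + S 0 (\<xi> 1) + S 1 (\<xi> 2)"
    have "(\<Sum>i<3. \<Sum>j<3. cinner ((W $$ (i, j)) (\<xi> j)) (\<xi> i)) = cinner ?v ?v"
      using orthogonal[OF less_n] orthogonal[OF less_n(2,1)]
      by (simp add: W_def arrow_def gen_def eval_nat_numeral cinner_simps S0.cinner_eq S1.cinner_eq
          S0.cinner_adj_left S1.cinner_adj_left)
    then show "0 \<le> (\<Sum>i<dim_row W. \<Sum>j<dim_col W. cinner ((W $$ (i, j)) (\<xi> j)) (\<xi> i))"
      using cinner_self_nonneg[of ?v] by (simp add: W_def)
  qed (simp add: W_def)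
  ultimately show ?thesis by simp
qed

lemma mat_u_mats: "mat 1 1 (\<lambda>_. u) \<in> mats 1 (tensor_space (cuntz_system n S) arrow_system)"
  using u_tensor_space by (simp add: mats_def)

text \<open>Applying \<open>\<phi>\<close> to the entries of \<open>W\<close> gives $(\varphi \otimes \mathrm{id})(u) \in M_k(T)^+$.\<close>

lemma u_min: "mat 1 1 (\<lambda>_. u) \<in> os_cone (tensor_min (cuntz_system n S) arrow_system) 1"
proof -
  have "psd (amplify 1 (k * m) (tensor_map k m \<phi> \<psi>) (mat 1 1 (\<lambda>_. u)))"
    if \<phi>: "ucp (cuntz_system n S) k \<phi>" and \<psi>: "ucp arrow_system m \<psi>" for k m \<phi> \<psi>
  proof -
    have lin: "linear_into_mats V k \<phi>" "linear_into_mats arrow_space m \<psi>"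
      using \<phi> \<psi> by (auto simp: ucp_def)
    define U where "U = mat k k (\<lambda>(a, b). \<Sum>l<5. \<phi> (gen l) $$ (a, b) *\<^sub>C coord l)"
    have "psd (amplify 3 k \<phi> W)" using \<phi> W_cone by (auto simp: ucp_def)
    then have pos: "pos_kernel {..<3 * k} (\<lambda>i j. amplify 3 k \<phi> W $$ (i, j))"
      by (simp add: psd_iff_pos_kernel[OF amplify_carrier])
    have index: "s * k + a < 3 * k" if "a < k" "s < 3" for a s :: nat
    proof -
      have "s * k + a < Suc s * k" using that by simp
      also have "\<dots> \<le> 3 * k" using that by (intro mult_right_mono) auto
      finally show ?thesis .
    qed
    \<comment> \<open>The canonical shuffle from M_3(M_k), where the row is
      \<open>s * k + a\<close>, to M_k(M_3), where it is the pair \<open>(a, s)\<close>.\<close>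
    have "pos_kernel (arrow_index k)
        (\<lambda>x y. amplify 3 k \<phi> W $$ (snd x * k + fst x, snd y * k + fst y))"
      by (rule pos_kernel_reindex[OF pos]) (auto intro: index)
    moreover have "arrow_kernel U x y = amplify 3 k \<phi> W $$ (snd x * k + fst x, snd y * k + fst y)"
      if x: "x \<in> arrow_index k" and y: "y \<in> arrow_index k" for x y
    proof -
      obtain a s b t where xy: "x = (a, s)" "y = (b, t)" "a < k" "s < 3" "b < k" "t < 3"
        using x y by auto
      have "amplify 3 k \<phi> W $$ (s * k + a, t * k + b) = \<phi> (arrow gen s t) $$ (a, b)"
        using xy index by (simp add: amplify_def W_def)
      also have "\<dots> = arrow (\<lambda>l. \<phi> (gen l) $$ (a, b)) s t"
        using linear_into_mats_zero[OF lin(1) subspace_V] xy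
        by (simp add: arrow_def del: gen_simps)
      \<comment> \<open>Cut off after coordinate 4, which \<open>arrow\<close> does not read beyond
        here, to obtain an element of \<open>arrow_space\<close>.\<close>
      also have "\<dots> = arrow (\<lambda>l. if l < 5 then \<phi> (gen l) $$ (a, b) else 0) s t"
        using xy by (simp add: arrow_def)
      also have "(\<lambda>l. if l < 5 then \<phi> (gen l) $$ (a, b) else 0) = U $$ (a, b)"
      proof -
        have "(\<lambda>l. if l < 5 then \<phi> (gen l) $$ (a, b) else 0) \<in> arrow_space"
          by (simp add: arrow_space_def)
        from arrow_space_expand[OF this] show ?thesis using xy by (simp add: U_def)
      qed
      finally show ?thesis using xy by (simp add: arrow_kernel_def)
    qed
    moreover have "U \<in> mats k arrow_space"
      by (auto simp: mats_def U_def intro!: cvec.subspace_sum cvec.subspace_scale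
          subspace_arrow_space coord_arrow_space)
    ultimately have "U \<in> os_cone arrow_system k"
      by (simp add: pos_kernel_cong[of _ "arrow_kernel U"])
    then have "psd (amplify k m \<psi> U)" using \<psi> by (auto simp: ucp_def)
    \<comment> \<open>Applying \<psi> to the entries of (\<phi> \<otimes> id)(u) gives (\<phi>
      \<otimes> \<psi>)(u), with the same splitting of an index into quotient and remainder by
      \<open>m\<close>.\<close>
    also have "amplify k m \<psi> U = amplify 1 (k * m) (tensor_map k m \<phi> \<psi>) (mat 1 1 (\<lambda>_. u))"
    proof (rule eq_matI)
      fix i j
      assume "i < dim_row (amplify 1 (k * m) (tensor_map k m \<phi> \<psi>) (mat 1 1 (\<lambda>_. u)))"
        and "j < dim_col (amplify 1 (k * m) (tensor_map k m \<phi> \<psi>) (mat 1 1 (\<lambda>_. u)))"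
      then have ij: "i < k * m" "j < k * m" by (simp_all add: amplify_def)
      then have "m > 0" by (cases m) auto
      with ij have idx: "i div m < k" "j div m < k" "i mod m < m" "j mod m < m"
        by (simp_all add: less_mult_imp_div_less)
      have "amplify k m \<psi> U $$ (i, j) = \<psi> (U $$ (i div m, j div m)) $$ (i mod m, j mod m)"
        using ij by (simp add: amplify_def)
      also have "\<dots> = (\<Sum>l<5. \<phi> (gen l) $$ (i div m, j div m) * \<psi> (coord l) $$ (i mod m, j mod m))"
        using idx(1,2) linear_into_mats_sum[OF lin(2) subspace_arrow_space _ _ idx(3,4),
            of "{..<5}" coord "\<lambda>l. \<phi> (gen l) $$ (i div m, j div m)"]
        by (simp add: U_def coord_arrow_space del: gen_simps)
      also have "\<dots> = u (\<lambda>x y. \<phi> x $$ (i div m, j div m) * \<psi> y $$ (i mod m, j mod m))"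
        by (simp add: u_apply[OF bilinear_form_prod[OF lin idx]])
      also have "\<dots> = amplify 1 (k * m) (tensor_map k m \<phi> \<psi>) (mat 1 1 (\<lambda>_. u)) $$ (i, j)"
        using ij by (simp add: amplify_def tensor_map_def)
      finally show "amplify k m \<psi> U $$ (i, j)
        = amplify 1 (k * m) (tensor_map k m \<phi> \<psi>) (mat 1 1 (\<lambda>_. u)) $$ (i, j)" .
    qed (simp_all add: amplify_def)
    finally show ?thesis .
  qed
  then show ?thesis using mat_u_mats by (simp add: tensor_min_def)
qed

text \<open>The sesquilinear form of F(c) = X (P \<otimes> c) X^*, where \<open>X\<close> is a row
  and \<open>c\<close> a scalar matrix of size \<open>m\<close>. For positive \<open>P\<close> this
  F is the completely positive map from M_m into the Cuntz system.\<close>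

definition pairing ::
  "nat \<Rightarrow> nat \<Rightarrow> ('h \<Rightarrow> 'h) mat \<Rightarrow> complex mat \<Rightarrow> (nat \<Rightarrow> nat \<Rightarrow> complex) \<Rightarrow> 'h \<Rightarrow> 'h \<Rightarrow> complex" where
  "pairing k m P X c \<xi> \<eta> = (\<Sum>a<k * m. \<Sum>b<k * m. X $$ (0, a) * cnj (X $$ (0, b)) *
    c (a mod m) (b mod m) * cinner ((P $$ (a div m, b div m)) \<xi>) \<eta>)"

lemma div_mod_less: "a < k * m \<Longrightarrow> a div m < k \<and> a mod m < (m::nat)"
  by (cases "m = 0") (simp_all add: less_mult_imp_div_less)

lemma pairing_cong:
  assumes "\<And>i j. i < m \<Longrightarrow> j < m \<Longrightarrow> c i j = d i j"
  shows "pairing k m P X c \<xi> \<eta> = pairing k m P X d \<xi> \<eta>"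
  unfolding pairing_def using assms div_mod_less by (intro sum.cong refl) auto

lemma pairing_add:
  "pairing k m P X (\<lambda>i j. c i j + d i j) \<xi> \<eta> = pairing k m P X c \<xi> \<eta> + pairing k m P X d \<xi> \<eta>"
  by (simp add: pairing_def distrib_left distrib_right sum.distrib)

lemma pairing_zero: "pairing k m P X (\<lambda>i j. 0) \<xi> \<eta> = 0"
  by (simp add: pairing_def)

lemma pairing_zero_right: "pairing k m P X c \<xi> 0 = 0"
  by (simp add: pairing_def)

lemma pairing_zero_left:
  assumes "P \<in> mats k V"
  shows "pairing k m P X c 0 \<eta> = 0"
proof -
  have "(P $$ (a div m, b div m)) 0 = 0" if "a < k * m" "b < k * m" for a b
  proof -
    have "P $$ (a div m, b div m) \<in> V" using assms div_mod_less that by (auto simp: mats_def)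
    from V_linear(2)[OF this, of 0 0] show ?thesis by simp
  qed
  then show ?thesis by (simp add: pairing_def)
qed

text \<open>F(c) is a linear combination of entries of \<open>P\<close>, all of which have the same
  quadratic form at the two vectors.\<close>

lemma pairing_swap:
  assumes "P \<in> mats k V"
  shows "pairing k m P X c (S 1 (S 0 x)) (S 1 (S 0 x)) = pairing k m P X c (S 0 (S 1 x)) (S 0 (S 1 x))"
  unfolding pairing_def
proof (intro sum.cong refl)
  fix a b assume "a \<in> {..<k * m}" "b \<in> {..<k * m}"
  then have "P $$ (a div m, b div m) \<in> V" using assms div_mod_less by (auto simp: mats_def)
  then show "X $$ (0, a) * cnj (X $$ (0, b)) * c (a mod m) (b mod m) *
        cinner ((P $$ (a div m, b div m)) (S 1 (S 0 x))) (S 1 (S 0 x))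
      = X $$ (0, a) * cnj (X $$ (0, b)) * c (a mod m) (b mod m) *
        cinner ((P $$ (a div m, b div m)) (S 0 (S 1 x))) (S 0 (S 1 x))"
    by (simp only: V_swap)
qed

text \<open>Positivity of P \<otimes> J for the all-ones matrix J of size \<open>m\<close>: its form
  at \<open>z\<close> is the form of \<open>P\<close> at the sums of \<open>z\<close> over the
  blocks of indices with equal quotient by \<open>m\<close>.\<close>

lemma op_mat_pos_blocks:
  assumes P: "P \<in> mats k V" and pos: "op_mat_pos P"
  shows "0 \<le> (\<Sum>a<k * m. \<Sum>b<k * m. cinner ((P $$ (a div m, b div m)) (z b)) (z a))"
proof -
  define A where "A = (\<lambda>\<alpha>. {a \<in> {..<k * m}. a div m = \<alpha>})"
  define \<zeta> where "\<zeta> = (\<lambda>\<alpha>. \<Sum>a\<in>A \<alpha>. z a)"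
  have group: "(\<Sum>\<alpha><k. \<Sum>a\<in>A \<alpha>. g a) = (\<Sum>a<k * m. g a)" for g :: "nat \<Rightarrow> complex"
    unfolding A_def using div_mod_less by (intro sum.group) auto
  have "(\<Sum>\<alpha><k. \<Sum>\<beta><k. cinner ((P $$ (\<alpha>, \<beta>)) (\<zeta> \<beta>)) (\<zeta> \<alpha>))
      = (\<Sum>\<alpha><k. \<Sum>\<beta><k. \<Sum>a\<in>A \<alpha>. \<Sum>b\<in>A \<beta>. cinner ((P $$ (\<alpha>, \<beta>)) (z b)) (z a))"
  proof (intro sum.cong refl)
    fix \<alpha> \<beta> assume "\<alpha> \<in> {..<k}" "\<beta> \<in> {..<k}"
    then have "P $$ (\<alpha>, \<beta>) \<in> V" using P by (simp add: mats_def)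
    then show "cinner ((P $$ (\<alpha>, \<beta>)) (\<zeta> \<beta>)) (\<zeta> \<alpha>)
        = (\<Sum>a\<in>A \<alpha>. \<Sum>b\<in>A \<beta>. cinner ((P $$ (\<alpha>, \<beta>)) (z b)) (z a))"
      by (simp add: \<zeta>_def V_sum cinner_sum_left cinner_sum_right)
  qed
  also have "\<dots> = (\<Sum>\<alpha><k. \<Sum>a\<in>A \<alpha>. \<Sum>\<beta><k. \<Sum>b\<in>A \<beta>. cinner ((P $$ (\<alpha>, \<beta>)) (z b)) (z a))"
    by (intro sum.cong refl sum.swap)
  also have "\<dots> = (\<Sum>\<alpha><k. \<Sum>a\<in>A \<alpha>. \<Sum>\<beta><k. \<Sum>b\<in>A \<beta>. cinner ((P $$ (a div m, b div m)) (z b)) (z a))"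
    by (intro sum.cong refl) (simp add: A_def)
  also have "\<dots> = (\<Sum>a<k * m. \<Sum>b<k * m. cinner ((P $$ (a div m, b div m)) (z b)) (z a))"
    by (simp only: group)
  finally have eq: "(\<Sum>\<alpha><k. \<Sum>\<beta><k. cinner ((P $$ (\<alpha>, \<beta>)) (\<zeta> \<beta>)) (\<zeta> \<alpha>))
      = (\<Sum>a<k * m. \<Sum>b<k * m. cinner ((P $$ (a div m, b div m)) (z b)) (z a))" .
  have dim: "dim_row P = k" "dim_col P = k" using P by (auto simp: mats_def)
  show ?thesis
    using pos unfolding op_mat_pos_def dim eq[symmetric] by blast
qed

text \<open>Complete positivity of F on 3 by 3 block matrices. For a rank one summand the scalars
  from \<open>X\<close> and \<nu> can be absorbed into the vectors, which reduces the claim to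
  \<open>op_mat_pos_blocks\<close>.\<close>

lemma pairing_gram_nonneg:
  assumes P: "P \<in> mats k V" and pos: "op_mat_pos P"
  shows "0 \<le> (\<Sum>s<3::nat. \<Sum>t<3::nat. pairing k m P X (\<lambda>i j. gram L (i, s) (j, t)) (\<xi> t) (\<xi> s))"
proof (induction L)
  case Nil
  then show ?case by (simp add: pairing_zero)
next
  case (Cons \<nu> L)
  define z where "z = (\<lambda>b. \<Sum>t<3::nat. cnj (X $$ (0, b) * \<nu> (b mod m, t)) *\<^sub>C \<xi> t)"
  have "0 \<le> (\<Sum>a<k * m. \<Sum>b<k * m. cinner ((P $$ (a div m, b div m)) (z b)) (z a))"
    using assms by (rule op_mat_pos_blocks)
  also have "\<dots> = (\<Sum>a<k * m. \<Sum>b<k * m. \<Sum>s<3. \<Sum>t<3. X $$ (0, a) * cnj (X $$ (0, b)) *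
    (\<nu> (a mod m, s) * cnj (\<nu> (b mod m, t))) * cinner ((P $$ (a div m, b div m)) (\<xi> t)) (\<xi> s))"
  proof (intro sum.cong refl)
    fix a b assume "a \<in> {..<k * m}" "b \<in> {..<k * m}"
    then have "P $$ (a div m, b div m) \<in> V" using P div_mod_less by (auto simp: mats_def)
    then show "cinner ((P $$ (a div m, b div m)) (z b)) (z a)
        = (\<Sum>s<3. \<Sum>t<3. X $$ (0, a) * cnj (X $$ (0, b)) *
          (\<nu> (a mod m, s) * cnj (\<nu> (b mod m, t))) * cinner ((P $$ (a div m, b div m)) (\<xi> t)) (\<xi> s))"
      by (simp add: z_def V_sum V_linear cinner_sum_left cinner_sum_right cinner_scaleC_left
          cinner_scaleC_right sum_distrib_left mult_ac)
  qed
  also have "\<dots> = (\<Sum>s<3. \<Sum>t<3. pairing k m P X (\<lambda>i j. \<nu> (i, s) * cnj (\<nu> (j, t))) (\<xi> t) (\<xi> s))"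
    unfolding pairing_def by (simp only: sum.swap[of _ "{..<3::nat}" "{..<k * m}"])
  finally show ?case using Cons by (simp add: pairing_add sum.distrib)
qed

section \<open>Failure of positivity in the maximal tensor product\<close>

lemma bilinear_form_apply:
  "(\<lambda>B f. cinner (B \<xi>) \<eta> * f l) \<in> bilinear_forms V arrow_space"
  by (simp add: bilinear_forms_def cinner_simps algebra_simps)

text \<open>Evaluating the tensor identity at the bilinear form that takes \<open>B\<close> and
  \<open>f\<close> to \<open>cinner (B \<xi>) \<eta> * f l\<close> reads off coordinate
  \<open>l\<close>: F maps the matrix of these coordinates of \<open>Q\<close> to
  \<open>gen l\<close>, plus \<epsilon> times the identity for \<open>l = 0\<close>.\<close>

lemma pairing_entry:
  assumes P: "P \<in> mats k V" and Q: "Q \<in> mats m arrow_space" and X: "X \<in> carrier_mat 1 (k * m)"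
    and eq: "diag 1 (complex_of_real \<epsilon> *\<^sub>C elem_tensor (cuntz_system n S) arrow_system id (coord 0))
      + mat 1 1 (\<lambda>_. u) = conjugation X (tensor_mat (cuntz_system n S) arrow_system k m P Q)"
    and l: "l < 5"
  shows "pairing k m P X (\<lambda>i j. (Q $$ (i, j)) l) \<xi> \<eta>
    = (if l = 0 then of_real \<epsilon> * cinner \<xi> \<eta> else 0) + cinner (gen l \<xi>) \<eta>"
proof -
  let ?\<beta> = "\<lambda>B f. cinner (B \<xi>) \<eta> * f l"
  note \<beta> = bilinear_form_apply[of \<xi> \<eta> l]
  have "(diag 1 (complex_of_real \<epsilon> *\<^sub>C elem_tensor (cuntz_system n S) arrow_system id (coord 0))
      + mat 1 1 (\<lambda>_. u)) $$ (0, 0) = conjugation X (tensor_mat (cuntz_system n S) arrow_system k m P Q) $$ (0, 0)"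
    by (simp only: eq)
  then have "complex_of_real \<epsilon> *\<^sub>C elem_tensor (cuntz_system n S) arrow_system id (coord 0) + u
      = (\<Sum>a<k * m. \<Sum>b<k * m. (X $$ (0, a) * cnj (X $$ (0, b))) *\<^sub>C
        elem_tensor (cuntz_system n S) arrow_system (P $$ (a div m, b div m)) (Q $$ (a mod m, b mod m)))"
    using X by (simp add: diag_def conjugation_def tensor_mat_def)
  then have "(complex_of_real \<epsilon> *\<^sub>C elem_tensor (cuntz_system n S) arrow_system id (coord 0) + u) ?\<beta>
      = (\<Sum>a<k * m. \<Sum>b<k * m. (X $$ (0, a) * cnj (X $$ (0, b))) *\<^sub>C
        elem_tensor (cuntz_system n S) arrow_system (P $$ (a div m, b div m)) (Q $$ (a mod m, b mod m))) ?\<beta>"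
    by (rule fun_cong)
  moreover have "(\<Sum>k<5. cinner (gen k \<xi>) \<eta> * coord k l) = cinner (gen l \<xi>) \<eta>"
    using l by (simp add: coord_def if_distrib[of "\<lambda>x. _ * x"] cong: if_cong del: gen_simps)
  ultimately show ?thesis
    using \<beta> by (simp add: u_apply sum_fun_apply elem_tensor_def pairing_def coord_def mult_ac
        del: gen_simps split: if_splits)
qed

lemma u_not_max: "mat 1 1 (\<lambda>_. u) \<notin> os_cone (tensor_max (cuntz_system n S) arrow_system) 1"
proof
  assume "mat 1 1 (\<lambda>_. u) \<in> os_cone (tensor_max (cuntz_system n S) arrow_system) 1"
  then have "\<forall>\<epsilon>::real. \<epsilon> > 0 \<longrightarrow> (\<exists>k m. \<exists>P \<in> os_cone (cuntz_system n S) k. \<exists>Q \<in> os_cone arrow_system m.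
      \<exists>X \<in> carrier_mat 1 (k * m).
        diag 1 (complex_of_real \<epsilon> *\<^sub>C elem_tensor (cuntz_system n S) arrow_system id (coord 0))
          + mat 1 1 (\<lambda>_. u)
          = conjugation X (tensor_mat (cuntz_system n S) arrow_system k m P Q))"
    by (simp add: tensor_max_def)
  \<comment> \<open>Any \<epsilon> below 1/3 violates 2 (1 - \<epsilon>) \<le> 1 + \<epsilon>; here
    it is 1/4.\<close>
  then have "\<exists>k m. \<exists>P \<in> os_cone (cuntz_system n S) k. \<exists>Q \<in> os_cone arrow_system m.
      \<exists>X \<in> carrier_mat 1 (k * m).
        diag 1 (complex_of_real (1/4) *\<^sub>C elem_tensor (cuntz_system n S) arrow_system id (coord 0))
          + mat 1 1 (\<lambda>_. u)
          = conjugation X (tensor_mat (cuntz_system n S) arrow_system k m P Q)"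
    by (rule allE[of _ "1/4"]) simp
  then obtain k m P Q X where P: "P \<in> mats k V" "op_mat_pos P"
    and Q: "Q \<in> mats m arrow_space" "pos_kernel (arrow_index m) (arrow_kernel Q)"
    and X: "X \<in> carrier_mat 1 (k * m)"
    and eq: "diag 1 (complex_of_real (1/4) *\<^sub>C elem_tensor (cuntz_system n S) arrow_system id (coord 0))
      + mat 1 1 (\<lambda>_. u) = conjugation X (tensor_mat (cuntz_system n S) arrow_system k m P Q)"
    by auto
  note entry = pairing_entry[OF P(1) Q(1) X eq]
  \<comment> \<open>The second and third block rows of \<open>Q\<close>, between which its entries
    are zero. The decomposition below gives a part \<open>L\<close> vanishing on \<open>K\<close>
    and a part \<open>M\<close> vanishing on \<open>J\<close>.\<close>
  define J K where "J = {..<m} \<times> {1::nat}" and "K = {..<m} \<times> {2::nat}"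
  obtain L M where L: "\<And>\<nu> x. \<nu> \<in> set L \<Longrightarrow> x \<in> K \<Longrightarrow> \<nu> x = 0"
    and M: "\<And>\<nu> x. \<nu> \<in> set M \<Longrightarrow> x \<in> J \<Longrightarrow> \<nu> x = 0"
    and LM: "\<And>x y. x \<in> arrow_index m \<Longrightarrow> y \<in> arrow_index m \<Longrightarrow>
      arrow_kernel Q x y = gram L x y + gram M x y"
  proof (rule pos_kernel_decomposition[OF Q(2), of J K])
    show "arrow_kernel Q x y = 0" if "x \<in> K" "y \<in> J" for x y
      using that by (auto simp: J_def K_def arrow_kernel_def arrow_def)
  qed (auto simp: J_def K_def)
  define F where "F = (\<lambda>L (s::nat) (t::nat). pairing k m P X (\<lambda>i j. gram L (i, s) (j, t)))"
  \<comment> \<open>The part \<open>M\<close> vanishes in the second block row and column, so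
    \<open>L\<close> carries the full entries of \<open>Q\<close> there.\<close>
  have F_eq: "F L s t \<xi> \<eta> = pairing k m P X (\<lambda>i j. arrow (Q $$ (i, j)) s t) \<xi> \<eta>"
    if "s < 3" "t < 3" "s = 1 \<or> t = 1" for s t \<xi> \<eta>
    unfolding F_def
  proof (rule pairing_cong)
    fix i j assume ij: "i < m" "j < m"
    then have "gram M (i, s) (j, t) = 0"
      using that M by (intro gram_eq_0) (auto simp: J_def)
    then show "gram L (i, s) (j, t) = arrow (Q $$ (i, j)) s t"
      using LM[of "(i, s)" "(j, t)"] ij that by (simp add: arrow_kernel_def)
  qed
  \<comment> \<open>In the third block row and column the roles are exchanged.\<close>
  have G_eq: "F M s t \<xi> \<eta> = pairing k m P X (\<lambda>i j. arrow (Q $$ (i, j)) s t) \<xi> \<eta>"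
    if "s < 3" "t < 3" "s = 2 \<or> t = 2" for s t \<xi> \<eta>
    unfolding F_def
  proof (rule pairing_cong)
    fix i j assume ij: "i < m" "j < m"
    then have "gram L (i, s) (j, t) = 0"
      using that L by (intro gram_eq_0) (auto simp: K_def)
    then show "gram M (i, s) (j, t) = arrow (Q $$ (i, j)) s t"
      using LM[of "(i, s)" "(j, t)"] ij that by (simp add: arrow_kernel_def)
  qed
  have zero: "F L s t 0 \<eta> = 0" "F L s t \<eta> 0 = 0" for L s t \<eta>
    by (simp_all add: F_def pairing_zero_left[OF P(1)] pairing_zero_right)
  have F_nonneg: "0 \<le> (\<Sum>s<3. \<Sum>t<3. F L s t (\<xi> t) (\<xi> s))" for L \<xi>
    unfolding F_def by (rule pairing_gram_nonneg[OF P])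
  obtain x :: 'h where "x \<noteq> 0" using S by (auto simp: cuntz_isometries_def)
  define N where "N = (norm x)\<^sup>2"
  have "N > 0" using \<open>x \<noteq> 0\<close> by (simp add: N_def)
  have N: "cinner x x = of_real N" by (simp add: cinner_self N_def)
  define v w where "v = S 1 (S 0 x)" and "w = S 0 (S 1 x)"
  have F: "F L 0 (Suc 0) \<xi> \<eta> = cinner (S 0 \<xi>) \<eta>" "F L (Suc 0) 0 \<xi> \<eta> = cinner (adj (S 0) \<xi>) \<eta>"
    "F L (Suc 0) (Suc 0) \<xi> \<eta> = of_real (5/4) * cinner \<xi> \<eta>" for \<xi> \<eta>
    by (simp_all add: F_eq arrow_entries entry algebra_simps)
  have G: "F M 0 2 \<xi> \<eta> = cinner (S 1 \<xi>) \<eta>" "F M 2 0 \<xi> \<eta> = cinner (adj (S 1) \<xi>) \<eta>"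
    "F M 2 2 \<xi> \<eta> = of_real (5/4) * cinner \<xi> \<eta>" for \<xi> \<eta>
    by (simp_all add: G_eq arrow_entries entry algebra_simps)
  \<comment> \<open>At the test vector (w, - S_2 x, 0) with w = S_1 S_2 x the cross terms contribute
    \<open>-2 * N\<close> and the lower corner \<open>5/4 * N\<close>.\<close>
  have "0 \<le> F L 0 0 w w - of_real (3/4 * N)"
    using F_nonneg[of L "\<lambda>s. if s = 0 then w else if s = 1 then S 1 (- x) else 0"]
    by (simp add: sum_lessThan_3 zero F w_def S0.adj_cancel S0.cinner_eq S1.cinner_eq
        cinner_minus_left cinner_minus_right N)
  moreover have "0 \<le> F M 0 0 v v - of_real (3/4 * N)"
    using F_nonneg[of M "\<lambda>s. if s = 0 then v else if s = 2 then S 0 (- x) else 0"]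
    by (simp add: sum_lessThan_3 zero G v_def S1.adj_cancel S0.cinner_eq S1.cinner_eq
        cinner_minus_left cinner_minus_right N)
  \<comment> \<open>The upper left corners of the two parts add up to the diagonal block of
    \<open>Q\<close>, which F maps to 1 + \<epsilon>.\<close>
  moreover have "F L 0 0 v v + F M 0 0 v v = of_real (5/4 * N)"
  proof -
    have "F L 0 0 v v + F M 0 0 v v = pairing k m P X (\<lambda>i j. (Q $$ (i, j)) 0) v v"
      unfolding F_def pairing_add[symmetric]
      by (rule pairing_cong) (simp add: LM[symmetric] arrow_kernel_def arrow_entries)
    also have "\<dots> = of_real (5/4 * N)"
      by (simp add: entry v_def S0.cinner_eq S1.cinner_eq N)
    finally show ?thesis .
  qed
  moreover have "F L 0 0 v v = F L 0 0 w w"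
    unfolding F_def v_def w_def by (rule pairing_swap[OF P(1)])
  \<comment> \<open>Replacing \<open>v\<close> by \<open>w\<close> in the part \<open>L\<close>
    gives a sum of at least \<open>3/2 * N\<close>, against the total
    \<open>5/4 * N\<close>.\<close>
  ultimately show False using \<open>N > 0\<close>
    by (simp add: less_eq_complex_def complex_eq_iff)
qed

end

theorem proposition2p1:
  fixes n :: enat and S :: "nat \<Rightarrow> 'h \<Rightarrow> 'h :: chilbert_space"
  assumes "2 \<le> n" and "cuntz_isometries n S"
  shows "\<exists>T :: (nat \<Rightarrow> complex) opsys. operator_system T \<and>
    \<not> same_matrix_order (tensor_min (cuntz_system n S) T) (tensor_max (cuntz_system n S) T)"
proof -
  interpret cuntz n S using assms by unfold_locales
  show ?thesis
    using operator_system_arrow_system u_min u_not_max by (auto simp: same_matrix_order_def)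
qed

end
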